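(* Let $m,N\ge 1$, let $\Omega\subset\mathbf{R}^N$ be an open set, let $H\in C^2(\mathbf{R}^m)$, and let $u=(u_i)_{i=1}^m\in C^2(\Omega)$ be a classical stable solution of $\Delta u=\nabla H(u)$ in $\Omega$. Then for any $\eta=(\eta_k)_{k=1}^m$ with $\eta_k\in C_c^1(\Omega)$, the following inequality holds: $$\sum_{i}\int_{\Omega}|\nabla u_i|^2|\nabla\eta_i|^2\ \ge\ \sum_{i}\int_{\{|\nabla u_i|\neq 0\}}\Big(|\nabla u_i|^2\mathcal{A}_i^2+|\nabla_T|\nabla u_i||^2\Big)\eta_i^2+\sum_{i\neq j}\int_{\Omega}\Big(\nabla u_i\cdot\nabla u_j\,\eta_i^2-|\nabla u_i||\nabla u_j|\,\eta_i\eta_j\Big)H_{u_iu_j}(u),$$ where $\nabla_T$ stands for the tangential gradient along a given level set of $u_i$ and $\mathcal{A}_i^2$ for the sum of the squares of the principal curvatures of such a level set.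
   Context: For $H\in C^2(\mathbf{R}^m)$, $H_{u_i}$ and $H_{u_iu_j}$ denote the first and second partial derivatives of $H$. The system $\Delta u=\nabla H(u)$ means $\Delta u_i=H_{u_i}(u_1,\dots,u_m)$ for $i=1,\dots,m$. A solution $u$ of the system on $\Omega$ is stable if $$\sum_{i}\int_{\Omega}|\nabla\zeta_i|^2\,dx+\sum_{i,j}\int_{\Omega}H_{u_iu_j}(u)\,\zeta_i\zeta_j\,dx\ge 0$$ for all $\zeta_1,\dots,\zeta_m\in C_c^1(\Omega)$. At a point $x\in\Omega$ with $\nabla u_i(x)\ne 0$, the level set of $u_i$ through $x$ is locally a $C^2$ hypersurface; $\mathcal{A}_i^2(x)$ is the sum of the squares of its $N-1$ principal curvatures at $x$, and $\nabla_T$ denotes the orthogonal projection of the gradient onto the tangent space of this level set at $x$. The set $\{|\nabla u_i|\neq 0\}$ is $\{x\in\Omega:\nabla u_i(x)\ne 0\}$. The sum $\sum_{i\ne j}$ runs over ordered pairs $(i,j)$ with $i\neq j$ in $\{1,\dots,m\}$. *)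

theory Defs
  imports "HOL-Analysis.Analysis"
begin

definition partial :: "'n \<Rightarrow> (real^'n \<Rightarrow> real) \<Rightarrow> real^'n \<Rightarrow> real" where
  "partial k f x = deriv (\<lambda>t. f (x + t *\<^sub>R axis k 1)) 0"

definition gradient :: "(real^'n \<Rightarrow> real) \<Rightarrow> real^'n \<Rightarrow> real^'n" where
  "gradient f x = (\<chi> k. partial k f x)"

definition laplacian :: "(real^'n \<Rightarrow> real) \<Rightarrow> real^'n \<Rightarrow> real" where
  "laplacian f x = (\<Sum>k\<in>UNIV. partial k (partial k f) x)"

(* C1_on and C2_on are meant for open S only. *)

definition C1_on :: "(real^'n) set \<Rightarrow> (real^'n \<Rightarrow> real) \<Rightarrow> bool" where
  "C1_on S f \<longleftrightarrow> f differentiable_on S \<and> (\<forall>k. continuous_on S (partial k f))"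

definition C2_on :: "(real^'n) set \<Rightarrow> (real^'n \<Rightarrow> real) \<Rightarrow> bool" where
  "C2_on S f \<longleftrightarrow> C1_on S f \<and> (\<forall>k. C1_on S (partial k f))"

(* Functions in C_c^1(Omega), identified with their extension by zero to the whole space. *)
definition C1_compact_support :: "(real^'n) set \<Rightarrow> (real^'n \<Rightarrow> real) \<Rightarrow> bool" where
  "C1_compact_support \<Omega> f \<longleftrightarrow> C1_on UNIV f \<and>
     compact (closure {x. f x \<noteq> 0}) \<and> closure {x. f x \<noteq> 0} \<subseteq> \<Omega>"

definition classical_solution ::
  "(real^'n) set \<Rightarrow> (real^'m \<Rightarrow> real) \<Rightarrow> (real^'n \<Rightarrow> real^'m) \<Rightarrow> bool" where
  "classical_solution \<Omega> H u \<longleftrightarrow>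
     (\<forall>i. C2_on \<Omega> (\<lambda>x. u x $ i)) \<and>
     (\<forall>x\<in>\<Omega>. \<forall>i. laplacian (\<lambda>y. u y $ i) x = partial i H (u x))"

definition stable_on ::
  "(real^'n) set \<Rightarrow> (real^'m \<Rightarrow> real) \<Rightarrow> (real^'n \<Rightarrow> real^'m) \<Rightarrow> bool" where
  "stable_on \<Omega> H u \<longleftrightarrow>
     (\<forall>\<zeta> :: 'm \<Rightarrow> real^'n \<Rightarrow> real. (\<forall>i. C1_compact_support \<Omega> (\<zeta> i)) \<longrightarrow>
        (\<Sum>i\<in>UNIV. LINT x:\<Omega>|lborel. (norm (gradient (\<zeta> i) x))\<^sup>2) +
        (\<Sum>i\<in>UNIV. \<Sum>j\<in>UNIV. LINT x:\<Omega>|lborel.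
           partial j (partial i H) (u x) * \<zeta> i x * \<zeta> j x) \<ge> 0)"

definition level_set :: "(real^'n) set \<Rightarrow> (real^'n \<Rightarrow> real) \<Rightarrow> real^'n \<Rightarrow> (real^'n) set" where
  "level_set \<Omega> f x = {y\<in>\<Omega>. f y = f x}"

(* Velocities at x of curves in M through x. *)
definition tangent_space :: "(real^'n) set \<Rightarrow> real^'n \<Rightarrow> (real^'n) set" where
  "tangent_space M x =
     {v. \<exists>\<gamma>. \<gamma> 0 = x \<and> (\<forall>\<^sub>F t in nhds 0. \<gamma> t \<in> M) \<and> (\<gamma> has_vector_derivative v) (at (0::real))}"

definition orthogonal_projection :: "(real^'n) set \<Rightarrow> real^'n \<Rightarrow> real^'n" where
  "orthogonal_projection T w = (THE p. p \<in> T \<and> (\<forall>v\<in>T. orthogonal (w - p) v))"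

definition tangential_gradient ::
  "(real^'n) set \<Rightarrow> (real^'n \<Rightarrow> real) \<Rightarrow> real^'n \<Rightarrow> real^'n" where
  "tangential_gradient M g x = orthogonal_projection (tangent_space M x) (gradient g x)"

(* In the next three definitions nu is a differentiable extension, to a neighbourhood of x,
   of a unit normal field along the hypersurface M. On tangent vectors its derivative does
   not depend on the extension. *)

definition shape_operator :: "(real^'n \<Rightarrow> real^'n) \<Rightarrow> real^'n \<Rightarrow> real^'n \<Rightarrow> real^'n" where
  "shape_operator \<nu> x v = - frechet_derivative \<nu> (at x) v"

definition principal_curvatures ::
  "(real^'n) set \<Rightarrow> (real^'n \<Rightarrow> real^'n) \<Rightarrow> real^'n \<Rightarrow> real set" where
  "principal_curvatures M \<nu> x =
     {\<kappa>. \<exists>v\<in>tangent_space M x. v \<noteq> 0 \<and> shape_operator \<nu> x v = \<kappa> *\<^sub>R v}"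

definition curvature_multiplicity ::
  "(real^'n) set \<Rightarrow> (real^'n \<Rightarrow> real^'n) \<Rightarrow> real^'n \<Rightarrow> real \<Rightarrow> nat" where
  "curvature_multiplicity M \<nu> x \<kappa> =
     dim {v\<in>tangent_space M x. shape_operator \<nu> x v = \<kappa> *\<^sub>R v}"

definition unit_normal :: "(real^'n \<Rightarrow> real) \<Rightarrow> real^'n \<Rightarrow> real^'n" where
  "unit_normal f y = gradient f y /\<^sub>R norm (gradient f y)"

(* The sum of the squares of the principal curvatures, counted with multiplicity, of the
   level set of f through a point x of Omega where the gradient of f does not vanish. *)
definition sum_sq_curvatures :: "(real^'n) set \<Rightarrow> (real^'n \<Rightarrow> real) \<Rightarrow> real^'n \<Rightarrow> real" where
  "sum_sq_curvatures \<Omega> f x =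
     (let M = level_set \<Omega> f x; \<nu> = unit_normal f
      in \<Sum>\<kappa>\<in>principal_curvatures M \<nu> x. real (curvature_multiplicity M \<nu> x \<kappa>) * \<kappa>\<^sup>2)"

end

theory Submission
  imports Defs
begin

text \<open>
  Write \<open>D\<^sup>2f\<close> for the matrix of second derivatives, and let \<open>n = \<nabla>f / |\<nabla>f|\<close> where \<open>\<nabla>f \<noteq> 0\<close>. An
  identity is subtracted from an inequality. Differentiating the equation gives the linearised system
  for \<open>\<partial>\<^sub>k u\<^sub>i\<close>. Testing it with \<open>\<partial>\<^sub>k u\<^sub>i \<eta>\<^sub>i\<^sup>2\<close> and summing over \<open>k\<close> yields an identity with the terms
  \<open>|D\<^sup>2u\<^sub>i|\<^sup>2 \<eta>\<^sub>i\<^sup>2\<close>, \<open>2 \<eta>\<^sub>i D\<^sup>2u\<^sub>i \<nabla>u\<^sub>i \<bullet> \<nabla>\<eta>\<^sub>i\<close> and \<open>H\<^sub>i\<^sub>j \<nabla>u\<^sub>i \<bullet> \<nabla>u\<^sub>j \<eta>\<^sub>i\<^sup>2\<close>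
  (\<open>linearized_energy_identity\<close>). Stability, applied to the functions \<open>|\<nabla>u\<^sub>i| \<eta>\<^sub>i\<close>, gives an inequality
  with the terms \<open>|D\<^sup>2u\<^sub>i n|\<^sup>2 \<eta>\<^sub>i\<^sup>2\<close>, the same cross term, \<open>|\<nabla>u\<^sub>i|\<^sup>2 |\<nabla>\<eta>\<^sub>i|\<^sup>2\<close> and
  \<open>H\<^sub>i\<^sub>j |\<nabla>u\<^sub>i| |\<nabla>u\<^sub>j| \<eta>\<^sub>i \<eta>\<^sub>j\<close>. The cross terms cancel in the difference, the diagonal terms with
  \<open>H\<^sub>i\<^sub>i\<close> cancel pointwise, and \<open>|D\<^sup>2u\<^sub>i|\<^sup>2 - |D\<^sup>2u\<^sub>i n|\<^sup>2\<close> is the geometric integrand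
  (\<open>curvature_identity\<close>). On the critical set of \<open>u\<^sub>i\<close> the nonnegative term \<open>|D\<^sup>2u\<^sub>i|\<^sup>2 \<eta>\<^sub>i\<^sup>2\<close> is dropped.

  The regularity assumptions leave two gaps in this argument. Third derivatives of \<open>u\<close> may fail to
  exist, so the linearised equation holds only in the weak sense. It is obtained from
  \<open>\<integral> \<partial>\<^sub>k v \<partial>\<^sub>l \<phi> = \<integral> \<partial>\<^sub>l v \<partial>\<^sub>k \<phi>\<close> for \<open>C\<^sup>1\<close> functions (\<open>integral_partial_swap\<close>), which follows from
  difference quotients and translation invariance of Lebesgue measure. Secondly, \<open>|\<nabla>u\<^sub>i|\<close> need not
  be differentiable at critical points of \<open>u\<^sub>i\<close>. It is replaced by \<open>w = (|\<nabla>u\<^sub>i|\<^sup>2 + \<epsilon>)\<^sup>1\<^sup>/\<^sup>2\<close>, which is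
  \<open>C\<^sup>1\<close>. Since \<open>w \<nabla>w = D\<^sup>2u\<^sub>i \<nabla>u\<^sub>i\<close> and \<open>|\<nabla>w| \<le> |D\<^sup>2u\<^sub>i n|\<close>, with \<open>\<nabla>w = 0\<close>
  on the critical set, the gradient terms are controlled for each \<open>\<epsilon>\<close> separately, up to an error
  linear in \<open>\<epsilon>\<close> (\<open>test_function_energy_le\<close>). Dominated convergence serves only for the terms
  with \<open>H\<close>.

  For the geometric identity, the tangent space of the level set is the hyperplane orthogonal to \<open>n\<close>
  (\<open>tangent_space_level_set\<close>), and the shape operator on it is \<open>- P D\<^sup>2f / |\<nabla>f|\<close>, with \<open>P\<close> the
  projection along \<open>n\<close>. By the spectral theorem (\<open>self_adjoint_orthonormal_eigenbasis\<close>) the sum of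
  the squared principal curvatures is the squared Frobenius norm of this operator.
\<close>

section \<open>Gradients and continuously differentiable functions\<close>

lemma has_derivative_axis_line:
  fixes f :: "real^'n \<Rightarrow> real"
  assumes "(f has_derivative f') (at (x + t *\<^sub>R axis k 1))"
  shows "((\<lambda>s. f (x + s *\<^sub>R axis k 1)) has_real_derivative f' (axis k 1)) (at t)"
proof -
  have "((\<lambda>s. x + s *\<^sub>R axis k (1::real)) has_derivative (\<lambda>s. s *\<^sub>R axis k 1)) (at t)"
    by (auto intro!: derivative_eq_intros)
  from diff_chain_at[OF this assms]
  have "((\<lambda>s. f (x + s *\<^sub>R axis k 1)) has_derivative (\<lambda>s. f' (s *\<^sub>R axis k 1))) (at t)"
    by (simp add: o_def)
  moreover have "f' (s *\<^sub>R axis k 1) = f' (axis k 1) * s" for s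
    using linear_cmul[OF has_derivative_linear[OF assms]] by simp
  ultimately show ?thesis by (simp add: has_field_derivative_def)
qed

lemma partial_eq:
  assumes "(f has_derivative f') (at x)"
  shows "partial k f x = f' (axis k 1)"
  unfolding partial_def
  by (rule DERIV_imp_deriv) (use has_derivative_axis_line[of f f' x 0 k] assms in simp)

lemma gradient_nth [simp]: "gradient f x $ k = partial k f x"
  by (simp add: gradient_def)

lemma gradient_eq:
  assumes "(f has_derivative (\<lambda>h. g \<bullet> h)) (at x)"
  shows "gradient f x = g"
  by (simp add: vec_eq_iff partial_eq[OF assms] inner_axis)

lemma has_derivative_gradient:
  fixes f :: "real^'n \<Rightarrow> real"
  assumes "f differentiable (at x)"
  shows "(f has_derivative (\<lambda>h. gradient f x \<bullet> h)) (at x)"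
proof -
  obtain f' where f': "(f has_derivative f') (at x)"
    using assms by (auto simp: differentiable_def)
  have lin: "linear f'" by (rule has_derivative_linear[OF f'])
  have "f' h = gradient f x \<bullet> h" for h
  proof -
    have "f' h = f' (\<Sum>k\<in>UNIV. (h $ k) *\<^sub>R axis k 1)"
      using basis_expansion[of h] by (simp add: scalar_mult_eq_scaleR)
    also have "\<dots> = (\<Sum>k\<in>UNIV. (h $ k) * f' (axis k 1))"
      by (simp add: linear_sum[OF lin] linear_cmul[OF lin])
    also have "\<dots> = gradient f x \<bullet> h"
      by (simp add: inner_vec_def partial_eq[OF f'] mult.commute)
    finally show ?thesis .
  qed
  then have "f' = (\<lambda>h. gradient f x \<bullet> h)" by auto
  with f' show ?thesis by simp
qed

lemma C1_on_has_derivative: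
  assumes "open S" "C1_on S f" "x \<in> S"
  shows "(f has_derivative (\<lambda>h. gradient f x \<bullet> h)) (at x)"
  using assms
  by (intro has_derivative_gradient)
     (auto simp: C1_on_def differentiable_on_eq_differentiable_at)

lemma C1_on_continuous: "C1_on S f \<Longrightarrow> continuous_on S f"
  by (simp add: C1_on_def differentiable_imp_continuous_on)

lemma C1_on_continuous_partial: "C1_on S f \<Longrightarrow> continuous_on S (partial k f)"
  by (simp add: C1_on_def)

lemma C1_on_continuous_gradient: "C1_on S f \<Longrightarrow> continuous_on S (gradient f)"
  unfolding gradient_def C1_on_def by (auto intro!: continuous_on_vec_lambda)

lemma C1_onI:
  fixes f :: "real^'n \<Rightarrow> real"
  assumes der: "\<And>x. x \<in> S \<Longrightarrow> (f has_derivative (\<lambda>h. g x \<bullet> h)) (at x)"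
    and cont: "continuous_on S g"
  shows "C1_on S f"
  unfolding C1_on_def
proof (intro conjI allI)
  show "f differentiable_on S"
    unfolding differentiable_on_def
    using der by (blast intro: differentiableI differentiable_at_withinI)
  fix k
  have "continuous_on S (\<lambda>x. g x $ k)" by (intro continuous_intros cont)
  moreover have "partial k f x = g x $ k" if "x \<in> S" for x
    using gradient_eq[OF der[OF that]] by (metis gradient_nth)
  ultimately show "continuous_on S (partial k f)"
    by (metis (no_types, lifting) continuous_on_cong)
qed

lemma C1_on_Un:
  assumes "open S" "open T" "C1_on S f" "C1_on T f"
  shows "C1_on (S \<union> T) f"
proof (rule C1_onI)
  show "(f has_derivative (\<lambda>h. gradient f x \<bullet> h)) (at x)" if "x \<in> S \<union> T" for x
    using that C1_on_has_derivative assms by blast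
  show "continuous_on (S \<union> T) (gradient f)"
    using assms C1_on_continuous_gradient by (blast intro: continuous_on_open_Un)
qed

lemma C1_on_subset: "C1_on T f \<Longrightarrow> S \<subseteq> T \<Longrightarrow> C1_on S f"
  unfolding C1_on_def by (meson continuous_on_subset differentiable_on_subset)

lemma has_derivative_mult_gradient:
  fixes f g :: "real^'n \<Rightarrow> real"
  assumes "(f has_derivative (\<lambda>h. a \<bullet> h)) (at x)" "(g has_derivative (\<lambda>h. b \<bullet> h)) (at x)"
  shows "((\<lambda>x. f x * g x) has_derivative (\<lambda>h. (f x *\<^sub>R b + g x *\<^sub>R a) \<bullet> h)) (at x)"
  by (rule has_derivative_eq_rhs[OF has_derivative_mult[OF assms]])
     (auto simp: inner_add_left algebra_simps)

lemma C1_on_mult: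
  assumes "open S" "C1_on S f" "C1_on S g"
  shows "C1_on S (\<lambda>x. f x * g x)"
proof (rule C1_onI)
  show "((\<lambda>x. f x * g x) has_derivative (\<lambda>h. (f x *\<^sub>R gradient g x + g x *\<^sub>R gradient f x) \<bullet> h)) (at x)"
    if "x \<in> S" for x
    using that assms by (intro has_derivative_mult_gradient C1_on_has_derivative) auto
  show "continuous_on S (\<lambda>x. f x *\<^sub>R gradient g x + g x *\<^sub>R gradient f x)"
    using assms by (intro continuous_intros C1_on_continuous C1_on_continuous_gradient)
qed

lemma gradient_mult:
  assumes "open S" "C1_on S f" "C1_on S g" "x \<in> S"
  shows "gradient (\<lambda>x. f x * g x) x = f x *\<^sub>R gradient g x + g x *\<^sub>R gradient f x"
  using assms by (intro gradient_eq has_derivative_mult_gradient C1_on_has_derivative) auto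

lemma C1_on_zero:
  assumes "open S" "\<And>x. x \<in> S \<Longrightarrow> f x = 0"
  shows "C1_on S f" and "x \<in> S \<Longrightarrow> gradient f x = 0"
proof -
  have der: "(f has_derivative (\<lambda>h. 0 \<bullet> h)) (at x)" if "x \<in> S" for x
    by (rule has_derivative_transform_within_open[of "\<lambda>_. 0" _ _ _ S]) (use that assms in auto)
  show "C1_on S f" by (rule C1_onI[of S f "\<lambda>_. 0"]) (use der in auto)
  show "x \<in> S \<Longrightarrow> gradient f x = 0" using gradient_eq[OF der] .
qed

section \<open>Compactly supported functions\<close>

lemma C1_compact_supportD:
  assumes "C1_compact_support S f"
  shows "C1_on UNIV f" "compact (closure {x. f x \<noteq> 0})" "closure {x. f x \<noteq> 0} \<subseteq> S"
  using assms by (auto simp: C1_compact_support_def)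

lemma eq_zero_off_support:
  assumes "x \<notin> closure {x. f x \<noteq> 0}"
  shows "f x = 0"
proof -
  have "x \<notin> {x. f x \<noteq> 0}" using assms closure_subset by (rule contra_subsetD[rotated])
  then show ?thesis by simp
qed

lemma gradient_zero_off_support:
  assumes "x \<notin> closure {x. f x \<noteq> 0}"
  shows "gradient f x = 0"
proof (rule C1_on_zero(2))
  show "open (- closure {x. f x \<noteq> 0})" by (simp add: open_Compl)
  show "f y = 0" if "y \<in> - closure {x. f x \<noteq> 0}" for y
    by (rule eq_zero_off_support) (use that in simp)
  show "x \<in> - closure {x. f x \<noteq> 0}" using assms by simp
qed

lemma partial_zero_off_support:
  assumes "x \<notin> closure {x. f x \<noteq> 0}"
  shows "partial k f x = 0"
  using gradient_zero_off_support[OF assms] by (metis gradient_nth zero_index)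

lemma C1_compact_supportI:
  assumes C1: "C1_on UNIV f" and K: "compact K" "K \<subseteq> S" "\<And>x. x \<notin> K \<Longrightarrow> f x = 0"
  shows "C1_compact_support S f"
proof -
  have sub: "closure {x. f x \<noteq> 0} \<subseteq> K"
    by (rule closure_minimal) (use K compact_imp_closed in auto)
  then have "compact (closure {x. f x \<noteq> 0})"
    using K compact_closure bounded_subset compact_imp_bounded closure_subset by metis
  with C1 sub K show ?thesis by (auto simp: C1_compact_support_def)
qed

text \<open>Outside \<open>S\<close> nothing is known about \<open>v\<close>, but there \<open>\<phi>\<close> vanishes on a whole neighbourhood
  of each point.\<close>
lemma C1_compact_support_mult:
  assumes S: "open S" "C1_on S v" and phi: "C1_compact_support S \<phi>"
  shows "C1_compact_support S (\<lambda>x. v x * \<phi> x)"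
proof (rule C1_compact_supportI[OF _ C1_compact_supportD(2,3)[OF phi]])
  let ?K = "closure {x. \<phi> x \<noteq> 0}"
  note D = C1_compact_supportD[OF phi]
  show zero: "v x * \<phi> x = 0" if "x \<notin> ?K" for x
    by (simp only: eq_zero_off_support[OF that] mult_zero_right)
  have "C1_on (S \<union> - ?K) (\<lambda>x. v x * \<phi> x)"
  proof (rule C1_on_Un)
    show "C1_on S (\<lambda>x. v x * \<phi> x)"
      using S C1_on_subset[OF D(1)] by (intro C1_on_mult) auto
    show "C1_on (- ?K) (\<lambda>x. v x * \<phi> x)"
      by (rule C1_on_zero(1), simp add: open_Compl, rule zero, simp)
  qed (use S in \<open>auto simp: open_Compl\<close>)
  moreover have "S \<union> - ?K = UNIV" using D(3) by auto
  ultimately show "C1_on UNIV (\<lambda>x. v x * \<phi> x)" by simp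
qed

lemma integrable_compactly_supported:
  fixes g :: "real^'n \<Rightarrow> real"
  assumes "compact K" "continuous_on K g" "\<And>x. x \<notin> K \<Longrightarrow> g x = 0"
  shows "integrable lborel g"
proof -
  have "integrable lborel (\<lambda>x. indicator K x *\<^sub>R g x)"
    by (rule borel_integrable_compact) (use assms in auto)
  moreover have "(\<lambda>x. indicator K x *\<^sub>R g x) = g"
    using assms(3) by (fastforce simp: indicator_def)
  ultimately show ?thesis by simp
qed

lemma set_lebesgue_integral_eq_UNIV:
  fixes g :: "real^'n \<Rightarrow> real"
  assumes "\<And>x. x \<notin> S \<Longrightarrow> g x = 0"
  shows "(LINT x:S|lborel. g x) = (LINT x|lborel. g x)"
  unfolding set_lebesgue_integral_def
  by (rule Bochner_Integration.integral_cong) (use assms in \<open>auto simp: indicator_def\<close>)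

lemma lborel_integral_translate:
  fixes f :: "real^'n \<Rightarrow> real"
  assumes "f \<in> borel_measurable borel"
  shows "(LINT x|lborel. f (x + a)) = (LINT x|lborel. f x)"
proof -
  have "(LINT x|lborel. f x) = (LINT x|distr lborel borel ((+) a). f x)"
    by (simp add: lborel_distr_plus)
  also have "\<dots> = (LINT x|lborel. f (a + x))"
    by (rule integral_distr) (use assms in auto)
  finally show ?thesis by (simp add: add.commute)
qed

section \<open>Integration by parts\<close>

lemma diff_quotient_bounded:
  fixes f :: "real^'n \<Rightarrow> real"
  assumes S: "open S" "C1_on S f" and sub: "cball x d \<subseteq> S"
    and bd: "\<And>y. y \<in> cball x d \<Longrightarrow> \<bar>partial k f y\<bar> \<le> M" and t: "\<bar>t\<bar> \<le> d"
  shows "\<bar>f (x + t *\<^sub>R axis k 1) - f x\<bar> \<le> M * \<bar>t\<bar>"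
proof -
  have in_ball: "x + s *\<^sub>R axis k 1 \<in> cball x d" if "\<bar>s\<bar> \<le> d" for s
    using that by (simp add: dist_norm)
  have der: "((\<lambda>s. f (x + s *\<^sub>R axis k 1)) has_real_derivative partial k f (x + s *\<^sub>R axis k 1)) (at s)"
    if "\<bar>s\<bar> \<le> d" for s
  proof -
    have "x + s *\<^sub>R axis k 1 \<in> S" using in_ball[OF that] sub by auto
    from has_derivative_axis_line[OF C1_on_has_derivative[OF S this]]
    show ?thesis by (simp add: inner_axis)
  qed
  have "norm (f (x + t *\<^sub>R axis k 1) - f (x + 0 *\<^sub>R axis k 1)) \<le> M * norm (t - 0)"
  proof (rule field_differentiable_bound[where S="cball 0 d"])
    show "((\<lambda>s. f (x + s *\<^sub>R axis k 1)) has_real_derivative partial k f (x + s *\<^sub>R axis k 1)) (at s within cball 0 d)"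
      if "s \<in> cball 0 d" for s
      using that der[of s] by (auto intro: has_field_derivative_at_within)
    show "norm (partial k f (x + s *\<^sub>R axis k 1)) \<le> M" if "s \<in> cball 0 d" for s
      using that bd in_ball[of s] by auto
  qed (use t in auto)
  then show ?thesis by simp
qed

lemma compact_fattening:
  fixes K :: "(real^'n) set"
  assumes "compact K"
  shows "compact (\<Union>x\<in>K. cball x d)"
proof -
  have "(\<Union>x\<in>K. cball x d) = {x + y |x y. x \<in> K \<and> y \<in> cball 0 d}"
  proof (intro set_eqI iffI)
    fix z assume "z \<in> (\<Union>x\<in>K. cball x d)"
    then obtain x where "x \<in> K" "z \<in> cball x d" by blast
    then have "z = x + (z - x) \<and> x \<in> K \<and> z - x \<in> cball 0 d"
      by (auto simp: dist_norm norm_minus_commute)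
    then show "z \<in> {x + y |x y. x \<in> K \<and> y \<in> cball 0 d}" by blast
  next
    fix z assume "z \<in> {x + y |x y. x \<in> K \<and> y \<in> cball 0 d}"
    then obtain x y where "z = x + y" "x \<in> K" "norm y \<le> d" by auto
    then show "z \<in> (\<Union>x\<in>K. cball x d)" by (intro UN_I[of x]) (auto simp: dist_norm)
  qed
  then show ?thesis using compact_sums[OF assms, of "cball 0 d"] by simp
qed

text \<open>Difference quotients converge to the partial derivative pointwise, and the mean value
  theorem bounds them uniformly near a compact set, so dominated convergence applies. The weight
  \<open>\<psi>\<close> may be discontinuous so that a function can be cut off by the indicator of a compact set.
  The shift \<open>c\<close> may be negative because moving a difference quotient from one factor of an
  integral to the other reverses its direction.\<close>
lemma diff_quotient_integral_tendsto:
  fixes f :: "real^'n \<Rightarrow> real"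
  assumes S: "open S" "C1_on S f" and K: "compact K" and sub: "(\<Union>x\<in>K. cball x \<bar>c\<bar>) \<subseteq> S"
    and c: "c \<noteq> 0"
    and psi: "\<psi> \<in> borel_measurable borel" "\<And>x. \<bar>\<psi> x\<bar> \<le> B" "\<And>x. x \<notin> K \<Longrightarrow> \<psi> x = 0"
  shows "(\<lambda>n. LINT x|lborel. (f (x + (c / real (Suc n)) *\<^sub>R axis k 1) - f x) / (c / real (Suc n)) * \<psi> x)
           \<longlonglongrightarrow> (LINT x|lborel. partial k f x * \<psi> x)"
proof -
  define h where "h n = c / real (Suc n)" for n
  have h0: "h n \<noteq> 0" for n using c by (simp add: h_def)
  have hle: "\<bar>h n\<bar> \<le> \<bar>c\<bar>" for n
    by (simp add: h_def abs_divide divide_le_eq mult_le_cancel_left1)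
  have hlim: "h \<longlonglongrightarrow> 0"
    unfolding h_def using LIMSEQ_Suc[OF lim_const_over_n[of c]] by simp
  define K' where "K' = (\<Union>x\<in>K. cball x \<bar>c\<bar>)"
  have K': "compact K'" unfolding K'_def by (rule compact_fattening[OF K])
  have KS: "K \<subseteq> S" using sub by force
  have "bounded (partial k f ` K')"
    using K' S(2) sub unfolding K'_def
    by (intro compact_imp_bounded compact_continuous_image)
       (auto intro: continuous_on_subset C1_on_continuous_partial)
  then obtain M where M: "\<And>y. y \<in> K' \<Longrightarrow> \<bar>partial k f y\<bar> \<le> M"
    by (auto simp: bounded_iff)
  have contf: "continuous_on K (\<lambda>x. f (x + t *\<^sub>R axis k 1))" if "\<bar>t\<bar> \<le> \<bar>c\<bar>" for t
  proof (rule continuous_on_compose2[OF C1_on_continuous[OF S(2)]])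
    show "(\<lambda>x. x + t *\<^sub>R axis k 1) ` K \<subseteq> S"
      using sub that by (force simp: dist_norm)
  qed (intro continuous_intros)
  let ?q = "\<lambda>n x. (f (x + h n *\<^sub>R axis k 1) - f x) / h n * \<psi> x"
  have ind: "g x * \<psi> x = (indicator K x *\<^sub>R g x) * \<psi> x" for g x
    using psi(3) by (auto simp: indicator_def)
  have meas: "(\<lambda>x. g x * \<psi> x) \<in> borel_measurable borel" if "continuous_on K g" for g
    unfolding ind[of g]
    by (intro borel_measurable_times psi borel_measurable_continuous_on_indicator that)
       (use K in \<open>auto intro: borel_closed compact_imp_closed\<close>)
  have B0: "0 \<le> B" using psi(2)[of undefined] by linarith
  have "(\<lambda>n. integral\<^sup>L lborel (?q n)) \<longlonglongrightarrow> (LINT x|lborel. partial k f x * \<psi> x)"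
  proof (rule integral_dominated_convergence[where w="\<lambda>x. indicator K x *\<^sub>R (M * B)"])
    show "(\<lambda>x. partial k f x * \<psi> x) \<in> borel_measurable lborel"
      using meas[of "partial k f"] S KS
      by (auto intro: continuous_on_subset C1_on_continuous_partial)
    show "?q n \<in> borel_measurable lborel" for n
    proof -
      have "continuous_on K (\<lambda>x. (f (x + h n *\<^sub>R axis k 1) - f x) / h n)"
        using contf[OF hle[of n]] contf[of 0] h0[of n] by (intro continuous_intros) auto
      from meas[OF this] show ?thesis by simp
    qed
    show "integrable lborel (\<lambda>x. indicator K x *\<^sub>R (M * B))"
      by (rule borel_integrable_compact[OF K]) auto
    show "AE x in lborel. (\<lambda>n. ?q n x) \<longlonglongrightarrow> partial k f x * \<psi> x"
    proof (rule AE_I2)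
      fix x
      show "(\<lambda>n. ?q n x) \<longlonglongrightarrow> partial k f x * \<psi> x"
      proof (cases "x \<in> K")
        case True
        then have "x \<in> S" using KS by auto
        then have "(f has_derivative (\<lambda>a. gradient f x \<bullet> a)) (at (x + 0 *\<^sub>R axis k 1))"
          using C1_on_has_derivative[OF S] by simp
        from has_derivative_axis_line[OF this]
        have "((\<lambda>s. f (x + s *\<^sub>R axis k 1)) has_real_derivative partial k f x) (at 0)"
          by (simp add: inner_axis)
        then have "((\<lambda>t. (f (x + t *\<^sub>R axis k 1) - f x) / t) \<longlongrightarrow> partial k f x) (at 0)"
          by (simp add: DERIV_def)
        then have "(\<lambda>n. (f (x + h n *\<^sub>R axis k 1) - f x) / h n) \<longlonglongrightarrow> partial k f x"
          by (rule filterlim_compose) (use hlim h0 in \<open>auto simp: filterlim_at\<close>)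
        then show ?thesis by (intro tendsto_intros)
      qed (simp add: psi(3))
    qed
    show "AE x in lborel. norm (?q n x) \<le> indicator K x *\<^sub>R (M * B)" for n
    proof (rule AE_I2)
      fix x
      show "norm (?q n x) \<le> indicator K x *\<^sub>R (M * B)"
      proof (cases "x \<in> K")
        case True
        then have cb: "cball x \<bar>c\<bar> \<subseteq> K'" by (auto simp: K'_def)
        have "x \<in> cball x \<bar>c\<bar>" by simp
        with M cb have M0: "0 \<le> M" by (meson abs_ge_zero order_trans subsetD)
        have "\<bar>f (x + h n *\<^sub>R axis k 1) - f x\<bar> \<le> M * \<bar>h n\<bar>"
          by (rule diff_quotient_bounded[OF S _ _ hle]) (use cb M sub[folded K'_def] in blast)+
        then have "\<bar>(f (x + h n *\<^sub>R axis k 1) - f x) / h n\<bar> \<le> M"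
          using h0[of n] by (simp add: abs_divide divide_le_eq)
        then have "\<bar>(f (x + h n *\<^sub>R axis k 1) - f x) / h n\<bar> * \<bar>\<psi> x\<bar> \<le> M * B"
          using psi(2)[of x] M0 by (intro mult_mono) auto
        then show ?thesis using True by (simp add: abs_mult)
      qed (simp add: psi(3))
    qed
  qed
  then show ?thesis unfolding h_def .
qed

text \<open>By translation invariance every difference quotient of a compactly supported function
  integrates to zero.\<close>
lemma integral_partial_zero:
  fixes F :: "real^'n \<Rightarrow> real"
  assumes F: "C1_compact_support S F"
  shows "(LINT x|lborel. partial k F x) = 0"
proof -
  note D = C1_compact_supportD[OF F]
  define K where "K = closure {x. F x \<noteq> 0}"
  define K' where "K' = (\<Union>x\<in>K. cball x 1)"
  have K: "compact K" using D(2) by (simp add: K_def)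
  have K': "compact K'" unfolding K'_def by (rule compact_fattening[OF K])
  have KK': "K \<subseteq> K'" by (force simp: K'_def)
  have F0: "F x = 0" if "x \<notin> K" for x using eq_zero_off_support that by (auto simp: K_def)
  have contF: "continuous_on UNIV F" by (rule C1_on_continuous[OF D(1)])
  have intF: "integrable lborel F"
    by (rule integrable_compactly_supported[OF K]) (use contF F0 in \<open>auto intro: continuous_on_subset\<close>)
  have mF: "F \<in> borel_measurable borel" using contF by (rule borel_measurable_continuous_onI)
  \<comment> \<open>\<open>K'\<close> contains the supports of \<open>F\<close> and of its translates by at most 1, so this weight does not
    change any of the integrals.\<close>
  have lim: "(\<lambda>n. LINT x|lborel. (F (x + (1 / real (Suc n)) *\<^sub>R axis k 1) - F x) / (1 / real (Suc n)) * indicator K' x)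
      \<longlonglongrightarrow> (LINT x|lborel. partial k F x * indicator K' x)"
    by (rule diff_quotient_integral_tendsto[OF open_UNIV D(1) K', where B=1])
       (use K' in \<open>auto simp: indicator_eq_0_iff intro!: borel_measurable_indicator borel_closed compact_imp_closed split: split_indicator\<close>)
  have zero: "(LINT x|lborel. (F (x + h *\<^sub>R axis k 1) - F x) / h * indicator K' x) = 0"
    if h: "0 < h" "h \<le> 1" for h
  proof -
    have eq: "(F (x + h *\<^sub>R axis k 1) - F x) / h * indicator K' x = (F (x + h *\<^sub>R axis k 1) - F x) / h" for x
    proof (cases "x \<in> K'")
      case False
      then have "x \<notin> K" using KK' by auto
      moreover have "x + h *\<^sub>R axis k 1 \<notin> K"
        using False h unfolding K'_def by (auto simp: dist_norm)
      ultimately show ?thesis using F0 by simp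
    qed simp
    have "integrable lborel (\<lambda>x. F (x + h *\<^sub>R axis k 1))"
    proof (rule integrable_compactly_supported[OF K'])
      show "continuous_on K' (\<lambda>x. F (x + h *\<^sub>R axis k 1))"
        by (rule continuous_on_compose2[OF contF]) (auto intro!: continuous_intros)
      show "F (x + h *\<^sub>R axis k 1) = 0" if "x \<notin> K'" for x
        using that h unfolding K'_def by (intro F0) (auto simp: dist_norm)
    qed
    then show ?thesis
      using intF lborel_integral_translate[OF mF] by (simp only: eq) simp
  qed
  have "(\<lambda>n::nat. 0) \<longlonglongrightarrow> (LINT x|lborel. partial k F x * indicator K' x)"
    using lim by (subst (asm) zero) auto
  then have "(LINT x|lborel. partial k F x * indicator K' x) = 0"
    by (simp add: LIMSEQ_const_iff)
  moreover have "partial k F x * indicator K' x = partial k F x" for x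
    using partial_zero_off_support[of x F k] KK' by (auto simp: indicator_def K_def)
  ultimately show ?thesis by simp
qed

lemma integral_by_parts:
  fixes v \<phi> :: "real^'n \<Rightarrow> real"
  assumes S: "open S" "C1_on S v" and phi: "C1_compact_support S \<phi>"
  shows "(LINT x|lborel. partial k v x * \<phi> x) = - (LINT x|lborel. v x * partial k \<phi> x)"
proof -
  define K where "K = closure {x. \<phi> x \<noteq> 0}"
  note D = C1_compact_supportD[OF phi, folded K_def]
  have phi0: "\<phi> x = 0" "partial k \<phi> x = 0" if "x \<notin> K" for x
    using that eq_zero_off_support partial_zero_off_support by (auto simp: K_def)
  have cont: "continuous_on K \<phi>" "continuous_on K (partial k \<phi>)"
      "continuous_on K v" "continuous_on K (partial k v)"
    using D S C1_on_continuous C1_on_continuous_partial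
    by (blast intro: continuous_on_subset subset_UNIV)+
  have int: "integrable lborel (\<lambda>x. v x * partial k \<phi> x)" "integrable lborel (\<lambda>x. partial k v x * \<phi> x)"
    by (rule integrable_compactly_supported[OF D(2)]; use phi0 in \<open>auto intro!: continuous_intros cont\<close>)+
  have "partial k (\<lambda>x. v x * \<phi> x) x = v x * partial k \<phi> x + partial k v x * \<phi> x" for x
  proof (cases "x \<in> K")
    case True
    then have "x \<in> S" using D by auto
    from gradient_mult[OF S C1_on_subset[OF D(1)] this]
    have "gradient (\<lambda>x. v x * \<phi> x) x $ k = (v x *\<^sub>R gradient \<phi> x + \<phi> x *\<^sub>R gradient v x) $ k" by simp
    then show ?thesis by (simp add: mult.commute)
  next
    case False
    have "{x. v x * \<phi> x \<noteq> 0} \<subseteq> {x. \<phi> x \<noteq> 0}" by auto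
    then have "x \<notin> closure {x. v x * \<phi> x \<noteq> 0}" using False closure_mono by (auto simp: K_def)
    then show ?thesis using phi0[OF False] partial_zero_off_support by force
  qed
  then have "0 = (LINT x|lborel. v x * partial k \<phi> x + partial k v x * \<phi> x)"
    using integral_partial_zero[OF C1_compact_support_mult[OF S phi], of k] by simp
  then show ?thesis using int by simp
qed

text \<open>Both sides equal minus the integral of \<open>v \<partial>\<^sub>k \<partial>\<^sub>l \<phi>\<close> if \<open>\<phi>\<close> is of class \<open>C\<^sup>2\<close>. For \<open>\<phi>\<close> of
  class \<open>C\<^sup>1\<close> one replaces the derivative in direction \<open>k\<close> by a difference quotient, which can be
  moved from one factor to the other by translating the integral, and integrates by parts in
  direction \<open>l\<close>.\<close>
lemma integral_partial_swap:
  fixes v \<phi> :: "real^'n \<Rightarrow> real"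
  assumes S: "open S" "C1_on S v" and phi: "C1_compact_support S \<phi>"
  shows "(LINT x|lborel. partial k v x * partial l \<phi> x) = (LINT x|lborel. partial l v x * partial k \<phi> x)"
proof -
  define K where "K = closure {x. \<phi> x \<noteq> 0}"
  note D = C1_compact_supportD[OF phi, folded K_def]
  obtain d where d: "d > 0" "(\<Union>x\<in>K. cball x d) \<subseteq> S"
    using compact_subset_open_imp_cball_epsilon_subset[OF D(2) S(1) D(3)] by blast
  define K' where "K' = (\<Union>x\<in>K. cball x d)"
  have K': "compact K'" "K' \<subseteq> S" using compact_fattening[OF D(2)] d by (auto simp: K'_def)
  have KK': "K \<subseteq> K'" using d by (force simp: K'_def)
  have phi0: "\<phi> x = 0" "partial j \<phi> x = 0" if "x \<notin> K" for x j
    using that eq_zero_off_support partial_zero_off_support by (auto simp: K_def)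
  have shift0: "x - h *\<^sub>R axis k 1 \<notin> K" "x + h *\<^sub>R axis k 1 \<notin> K" if "x \<notin> K'" "0 < h" "h \<le> d" for x h
    using that unfolding K'_def by (auto simp: dist_norm)
  have cphi: "continuous_on T \<phi>" "continuous_on T (partial j \<phi>)" for T j
    using D C1_on_continuous C1_on_continuous_partial
    by (blast intro: continuous_on_subset subset_UNIV)+
  have cv: "continuous_on K' v" "continuous_on K' (partial j v)" for j
    using K' S C1_on_continuous C1_on_continuous_partial
    by (blast intro: continuous_on_subset)+
  have int: "integrable lborel g"
    if "continuous_on K' g" "\<And>x. x \<notin> K' \<Longrightarrow> g x = 0" for g :: "real^'n \<Rightarrow> real"
    using integrable_compactly_supported[OF K'(1)] that by blast
  \<comment> \<open>Nothing is known about \<open>\<partial>\<^sub>l v\<close> outside \<open>S\<close>. The cut-off is bounded and measurable, and it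
    agrees with \<open>\<partial>\<^sub>l v\<close> on the supports of \<open>\<phi>\<close> and of its translates.\<close>
  define w where "w x = partial l v x * indicator K' x" for x
  have wphi: "g x * w x = g x * partial l v x" if "\<And>x. x \<notin> K' \<Longrightarrow> g x = 0" for g x
    using that by (auto simp: w_def indicator_def)

  have step: "(LINT x|lborel. (v (x + h *\<^sub>R axis k 1) - v x) / h * partial l \<phi> x)
       = (LINT x|lborel. (\<phi> (x + (- h) *\<^sub>R axis k 1) - \<phi> x) / (- h) * w x)"
    if h: "0 < h" "h \<le> d" for h
  proof -
    let ?e = "h *\<^sub>R axis k (1::real)"
    define \<psi> where "\<psi> x = \<phi> (x - ?e) - \<phi> x" for x
    have derpsi: "(\<psi> has_derivative (\<lambda>a. (gradient \<phi> (x - ?e) - gradient \<phi> x) \<bullet> a)) (at x)" for x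
    proof -
      have "(\<phi> has_derivative (\<lambda>a. gradient \<phi> (x - ?e) \<bullet> a)) (at (x - ?e))"
        "(\<phi> has_derivative (\<lambda>a. gradient \<phi> x \<bullet> a)) (at x)"
        by (rule C1_on_has_derivative[OF open_UNIV D(1)]; simp)+
      moreover have "((\<lambda>x. x - ?e) has_derivative (\<lambda>a. a)) (at x)"
        by (auto intro!: derivative_eq_intros)
      ultimately have "((\<lambda>x. \<phi> (x - ?e) - \<phi> x) has_derivative
          (\<lambda>a. gradient \<phi> (x - ?e) \<bullet> a - gradient \<phi> x \<bullet> a)) (at x)"
        using diff_chain_at[of "\<lambda>x. x - ?e" "\<lambda>a. a" x \<phi>] has_derivative_diff by (fastforce simp: o_def)
      then show ?thesis by (simp add: \<psi>_def[abs_def] inner_diff_left)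
    qed
    have psi: "C1_compact_support S \<psi>"
    proof (rule C1_compact_supportI[OF _ K'])
      show "C1_on UNIV \<psi>"
        by (rule C1_onI[OF derpsi])
           (auto intro!: continuous_intros continuous_on_compose2[OF C1_on_continuous_gradient[OF D(1)]])
      show "\<psi> x = 0" if "x \<notin> K'" for x
        using phi0(1) shift0[OF that h] that KK' by (auto simp: \<psi>_def)
    qed
    have "partial l \<psi> x = partial l \<phi> (x - ?e) - partial l \<phi> x" for x
      using gradient_eq[OF derpsi, of x] by (metis gradient_nth vector_minus_component)
    then have "(LINT x|lborel. partial l v x * \<psi> x)
        = - (LINT x|lborel. v x * (partial l \<phi> (x - ?e) - partial l \<phi> x))"
      using integral_by_parts[OF S psi, of l] by simp
    also have "\<dots> = - (LINT x|lborel. v x * partial l \<phi> (x - ?e)) + (LINT x|lborel. v x * partial l \<phi> x)"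
    proof -
      have "integrable lborel (\<lambda>x. v x * partial l \<phi> x)"
        by (rule int) (use phi0 KK' in \<open>auto intro!: continuous_intros cv cphi\<close>)
      moreover have int2: "integrable lborel (\<lambda>x. v x * partial l \<phi> (x - ?e))"
        by (rule int) (use phi0 shift0[OF _ h] in
          \<open>auto intro!: continuous_intros cv continuous_on_compose2[OF cphi(2)[of UNIV]]\<close>)
      ultimately show ?thesis by (simp add: right_diff_distrib)
    qed
    also have "(LINT x|lborel. v x * partial l \<phi> (x - ?e)) = (LINT x|lborel. v (x + ?e) * partial l \<phi> x)"
    proof -
      have "integrable lborel (\<lambda>x. v x * partial l \<phi> (x - ?e))"
        by (rule int) (use phi0 shift0[OF _ h] in
          \<open>auto intro!: continuous_intros cv continuous_on_compose2[OF cphi(2)[of UNIV]]\<close>)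
      then have "(\<lambda>x. v x * partial l \<phi> (x - ?e)) \<in> borel_measurable borel" by auto
      from lborel_integral_translate[OF this, of ?e] show ?thesis by simp
    qed
    also have "- (LINT x|lborel. v (x + ?e) * partial l \<phi> x) + (LINT x|lborel. v x * partial l \<phi> x)
        = - (LINT x|lborel. (v (x + ?e) - v x) * partial l \<phi> x)"
    proof -
      have "integrable lborel (\<lambda>x. v x * partial l \<phi> x)"
        by (rule int) (use phi0 KK' in \<open>auto intro!: continuous_intros cv cphi\<close>)
      moreover have "integrable lborel (\<lambda>x. v (x + ?e) * partial l \<phi> x)"
      proof (rule integrable_compactly_supported[OF D(2)])
        show "continuous_on K (\<lambda>x. v (x + ?e) * partial l \<phi> x)"
          by (intro continuous_intros cphi continuous_on_compose2[OF cv(1)])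
             (use h in \<open>auto simp: K'_def dist_norm\<close>)
      qed (use phi0 in auto)
      ultimately show ?thesis by (simp add: left_diff_distrib)
    qed
    finally have *: "(LINT x|lborel. (v (x + ?e) - v x) * partial l \<phi> x)
        = - (LINT x|lborel. partial l v x * \<psi> x)" by simp
    have "(LINT x|lborel. (v (x + ?e) - v x) / h * partial l \<phi> x)
        = (LINT x|lborel. (v (x + ?e) - v x) * partial l \<phi> x) / h"
      by (simp add: times_divide_eq_left)
    also have "\<dots> = (LINT x|lborel. partial l v x * \<psi> x) / (- h)"
      by (simp add: *)
    also have "\<dots> = (LINT x|lborel. \<psi> x / (- h) * w x)"
    proof -
      have "\<psi> x / (- h) * w x = partial l v x * \<psi> x / (- h)" for x
        using wphi[of \<psi> x] phi0(1) shift0[OF _ h] KK' by (auto simp: \<psi>_def)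
      then show ?thesis by (simp only: integral_divide_zero)
    qed
    finally show ?thesis by (simp add: \<psi>_def)
  qed

  have bounded_by: "\<exists>B. \<forall>x\<in>T. \<bar>g x\<bar> \<le> B" if "compact T" "continuous_on T g" for g :: "real^'n \<Rightarrow> real" and T
    using compact_imp_bounded[OF compact_continuous_image[OF that(2,1)]] by (auto simp: bounded_iff)
  obtain B1 where B1: "\<And>x. x \<in> K \<Longrightarrow> \<bar>partial l \<phi> x\<bar> \<le> B1"
    using bounded_by[OF D(2) cphi(2)] by blast
  have lim1: "(\<lambda>n. LINT x|lborel. (v (x + (d / real (Suc n)) *\<^sub>R axis k 1) - v x) / (d / real (Suc n)) * partial l \<phi> x)
           \<longlonglongrightarrow> (LINT x|lborel. partial k v x * partial l \<phi> x)"
  proof (rule diff_quotient_integral_tendsto[OF S D(2)])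
    show "partial l \<phi> \<in> borel_measurable borel" by (rule borel_measurable_continuous_onI[OF cphi(2)])
    show "\<bar>partial l \<phi> x\<bar> \<le> max B1 0" for x
      using B1 phi0 by (cases "x \<in> K") (auto simp: le_max_iff_disj)
  qed (use d phi0 in auto)
  obtain B2 where B2: "\<And>x. x \<in> K' \<Longrightarrow> \<bar>partial l v x\<bar> \<le> B2"
    using bounded_by[OF K'(1) cv(2)] by blast
  have lim2: "(\<lambda>n. LINT x|lborel. (\<phi> (x + (- d / real (Suc n)) *\<^sub>R axis k 1) - \<phi> x) / (- d / real (Suc n)) * w x)
           \<longlonglongrightarrow> (LINT x|lborel. partial k \<phi> x * w x)"
  proof (rule diff_quotient_integral_tendsto[OF open_UNIV D(1) K'(1)])
    have "(\<lambda>x. indicator K' x *\<^sub>R partial l v x) \<in> borel_measurable borel"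
      by (rule borel_measurable_continuous_on_indicator[OF _ cv(2)]) (use K' in \<open>auto intro: borel_closed compact_imp_closed\<close>)
    then show "w \<in> borel_measurable borel" by (simp add: w_def[abs_def] mult.commute)
    show "\<bar>w x\<bar> \<le> max B2 0" for x
      using B2 by (cases "x \<in> K'") (auto simp: le_max_iff_disj w_def)
  qed (use d in \<open>auto simp: w_def\<close>)
  have "(LINT x|lborel. (v (x + (d / real (Suc n)) *\<^sub>R axis k 1) - v x) / (d / real (Suc n)) * partial l \<phi> x)
     = (LINT x|lborel. (\<phi> (x + (- d / real (Suc n)) *\<^sub>R axis k 1) - \<phi> x) / (- d / real (Suc n)) * w x)" for n
    using step[of "d / real (Suc n)"] d(1) by (simp add: divide_le_eq)
  with lim1 lim2 have "(LINT x|lborel. partial k v x * partial l \<phi> x) = (LINT x|lborel. partial k \<phi> x * w x)"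
    using LIMSEQ_unique by simp
  also have "\<dots> = (LINT x|lborel. partial k \<phi> x * partial l v x)"
    by (rule arg_cong[of _ _ "integral\<^sup>L lborel"], rule ext, rule wphi) (use phi0 KK' in blast)
  finally show ?thesis by (simp add: mult.commute)
qed

section \<open>Symmetry of second partial derivatives\<close>

lemma C2_onD:
  assumes "C2_on S f"
  shows "C1_on S f" "C1_on S (partial k f)"
  using assms by (auto simp: C2_on_def)

text \<open>The mean value theorem is applied first in direction \<open>k\<close>, then in direction \<open>l\<close>. The second
  difference on the left is symmetric in \<open>k\<close> and \<open>l\<close>, whereas the derivative on the right is not
  visibly so; this asymmetry gives the interchange of partial derivatives.\<close>
lemma second_difference_mean_value:
  fixes f :: "real^'n \<Rightarrow> real"
  assumes S: "open S" "C2_on S f" and h: "0 < h" "cball x (2 * h) \<subseteq> S"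
  shows "\<exists>p\<in>cball x (2 * h). f (x + h *\<^sub>R axis k 1 + h *\<^sub>R axis l 1) - f (x + h *\<^sub>R axis k 1)
      - f (x + h *\<^sub>R axis l 1) + f x = h * h * partial l (partial k f) p"
proof -
  note C1 = C2_onD[OF S(2)]
  have in_ball: "x + s *\<^sub>R axis k 1 + t *\<^sub>R axis l 1 \<in> cball x (2 * h)"
    if "0 \<le> s" "s \<le> h" "0 \<le> t" "t \<le> h" for s t
  proof -
    have "norm (s *\<^sub>R axis k (1::real) + t *\<^sub>R axis l 1) \<le> \<bar>s\<bar> + \<bar>t\<bar>"
      by (rule norm_triangle_le) simp
    moreover have "dist x (x + s *\<^sub>R axis k 1 + t *\<^sub>R axis l 1) = norm (s *\<^sub>R axis k (1::real) + t *\<^sub>R axis l 1)"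
      by (metis add.assoc add_diff_cancel_left' dist_norm norm_minus_commute)
    ultimately show ?thesis using that by simp
  qed
  have der: "((\<lambda>s. f (x + s *\<^sub>R axis k 1 + t *\<^sub>R axis l 1)) has_real_derivative
        partial k f (x + s *\<^sub>R axis k 1 + t *\<^sub>R axis l 1)) (at s)"
    if "0 \<le> s" "s \<le> h" "0 \<le> t" "t \<le> h" for s t
  proof -
    have "((x + t *\<^sub>R axis l 1) + s *\<^sub>R axis k 1) \<in> S"
      using in_ball[OF that] h(2) by (auto simp: add_ac)
    from has_derivative_axis_line[OF C1_on_has_derivative[OF S(1) C1(1) this]]
    show ?thesis by (simp add: inner_axis add_ac)
  qed
  have der2: "((\<lambda>t. partial k f (x + s *\<^sub>R axis k 1 + t *\<^sub>R axis l 1)) has_real_derivative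
        partial l (partial k f) (x + s *\<^sub>R axis k 1 + t *\<^sub>R axis l 1)) (at t)"
    if "0 \<le> s" "s \<le> h" "0 \<le> t" "t \<le> h" for s t
  proof -
    have "((x + s *\<^sub>R axis k 1) + t *\<^sub>R axis l 1) \<in> S"
      using in_ball[OF that] h(2) by auto
    from has_derivative_axis_line[OF C1_on_has_derivative[OF S(1) C1(2) this]]
    show ?thesis by (simp add: inner_axis)
  qed
  have "\<exists>s. 0 < s \<and> s < h \<and>
      (f (x + h *\<^sub>R axis k 1 + h *\<^sub>R axis l 1) - f (x + h *\<^sub>R axis k 1 + 0 *\<^sub>R axis l 1))
      - (f (x + 0 *\<^sub>R axis k 1 + h *\<^sub>R axis l 1) - f (x + 0 *\<^sub>R axis k 1 + 0 *\<^sub>R axis l 1))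
      = (h - 0) * (partial k f (x + s *\<^sub>R axis k 1 + h *\<^sub>R axis l 1)
                    - partial k f (x + s *\<^sub>R axis k 1 + 0 *\<^sub>R axis l 1))"
    using h(1) by (intro MVT2 DERIV_diff der) auto
  then obtain s where s: "0 < s" "s < h"
    and eq1: "f (x + h *\<^sub>R axis k 1 + h *\<^sub>R axis l 1) - f (x + h *\<^sub>R axis k 1)
      - f (x + h *\<^sub>R axis l 1) + f x
      = h * (partial k f (x + s *\<^sub>R axis k 1 + h *\<^sub>R axis l 1)
                    - partial k f (x + s *\<^sub>R axis k 1 + 0 *\<^sub>R axis l 1))"
    by auto
  have "\<exists>t. 0 < t \<and> t < h \<and>
      partial k f (x + s *\<^sub>R axis k 1 + h *\<^sub>R axis l 1) - partial k f (x + s *\<^sub>R axis k 1 + 0 *\<^sub>R axis l 1)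
      = (h - 0) * partial l (partial k f) (x + s *\<^sub>R axis k 1 + t *\<^sub>R axis l 1)"
    using h(1) s by (intro MVT2 der2) auto
  then obtain t where t: "0 < t" "t < h"
    and eq2: "partial k f (x + s *\<^sub>R axis k 1 + h *\<^sub>R axis l 1) - partial k f (x + s *\<^sub>R axis k 1 + 0 *\<^sub>R axis l 1)
      = h * partial l (partial k f) (x + s *\<^sub>R axis k 1 + t *\<^sub>R axis l 1)"
    by auto
  show ?thesis
    using eq1 in_ball[of s t] s t unfolding eq2 by (intro bexI) auto
qed

lemma partial_commute:
  fixes f :: "real^'n \<Rightarrow> real"
  assumes S: "open S" "C2_on S f" and x: "x \<in> S"
  shows "partial k (partial l f) x = partial l (partial k f) x"
proof -
  obtain r where r: "r > 0" "cball x r \<subseteq> S"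
    using S(1) x open_contains_cball by blast
  define h where "h n = r / 2 / real (Suc n)" for n
  have h: "0 < h n" "cball x (2 * h n) \<subseteq> S" for n
  proof -
    show "0 < h n" using r by (simp add: h_def)
    have "2 * h n \<le> r" using r by (simp add: h_def field_simps)
    then show "cball x (2 * h n) \<subseteq> S" using r(2) by (meson order_trans subset_cball)
  qed
  have hlim: "(\<lambda>n. 2 * h n) \<longlonglongrightarrow> 0"
    using tendsto_mult_right_zero[OF LIMSEQ_Suc[OF lim_const_over_n[of "r/2"]], of 2] by (simp add: h_def)
  have "\<exists>p\<in>cball x (2 * h n). \<exists>q\<in>cball x (2 * h n). partial l (partial k f) p = partial k (partial l f) q" for n
  proof -
    let ?a = "axis k (1::real)" and ?b = "axis l (1::real)"
    obtain p where p: "p \<in> cball x (2 * h n)" "f (x + h n *\<^sub>R ?a + h n *\<^sub>R ?b) - f (x + h n *\<^sub>R ?a)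
      - f (x + h n *\<^sub>R ?b) + f x = h n * h n * partial l (partial k f) p"
      using second_difference_mean_value[OF S h] by blast
    obtain q where q: "q \<in> cball x (2 * h n)" "f (x + h n *\<^sub>R ?b + h n *\<^sub>R ?a) - f (x + h n *\<^sub>R ?b)
      - f (x + h n *\<^sub>R ?a) + f x = h n * h n * partial k (partial l f) q"
      using second_difference_mean_value[OF S h] by blast
    have eq: "x + h n *\<^sub>R ?b + h n *\<^sub>R ?a = x + h n *\<^sub>R ?a + h n *\<^sub>R ?b" by (simp add: add_ac)
    then have "h n * h n * partial l (partial k f) p = h n * h n * partial k (partial l f) q"
      using p(2) q(2) unfolding eq by linarith
    then have "partial l (partial k f) p = partial k (partial l f) q"
      using h(1)[of n] by simp
    then show ?thesis using p(1) q(1) by blast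
  qed
  then obtain p q where pq: "\<And>n. p n \<in> cball x (2 * h n)" "\<And>n. q n \<in> cball x (2 * h n)"
    "\<And>n. partial l (partial k f) (p n) = partial k (partial l f) (q n)" by metis
  have to_x: "w \<longlonglongrightarrow> x" if "\<And>n. w n \<in> cball x (2 * h n)" for w
    by (rule metric_tendsto_imp_tendsto[OF hlim])
       (use that h(1) in \<open>auto simp: dist_commute less_imp_le intro!: always_eventually\<close>)
  have cont: "isCont (partial i (partial j f)) x" for i j
    using C1_on_continuous_partial[OF C2_onD(2)[OF S(2)]] S(1) x continuous_on_eq_continuous_at by blast
  have "(\<lambda>n. partial l (partial k f) (p n)) \<longlonglongrightarrow> partial l (partial k f) x"
    by (rule isCont_tendsto_compose[OF cont to_x[OF pq(1)]])
  moreover have "(\<lambda>n. partial l (partial k f) (p n)) \<longlonglongrightarrow> partial k (partial l f) x"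
    unfolding pq(3) by (rule isCont_tendsto_compose[OF cont to_x[OF pq(2)]])
  ultimately show ?thesis using LIMSEQ_unique by metis
qed

section \<open>The second derivative\<close>

text \<open>The second derivative is kept as a linear map, since only its action on the gradient, on the
  normal and on the vectors of an orthonormal basis matters.\<close>
definition hess :: "(real^'n \<Rightarrow> real) \<Rightarrow> real^'n \<Rightarrow> real^'n \<Rightarrow> real^'n" where
  "hess f x v = (\<chi> k. gradient (partial k f) x \<bullet> v)"

lemma linear_hess: "linear (hess f x)"
  by (rule linearI) (auto simp: hess_def vec_eq_iff inner_add_right)

lemma gradient_has_derivative_hess:
  fixes f :: "real^'n \<Rightarrow> real"
  assumes S: "open S" "C2_on S f" and x: "x \<in> S"
  shows "(gradient f has_derivative hess f x) (at x)"
proof (subst has_derivative_componentwise_within, rule ballI)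
  fix i :: "real^'n" assume "i \<in> Basis"
  then obtain k where k: "i = axis k 1" by (auto simp: Basis_vec_def)
  show "((\<lambda>y. gradient f y \<bullet> i) has_derivative (\<lambda>v. hess f x v \<bullet> i)) (at x)"
    using C1_on_has_derivative[OF S(1) C2_onD(2)[OF S(2)] x, of k]
    by (simp add: k inner_axis hess_def)
qed

lemma hess_symmetric:
  fixes f :: "real^'n \<Rightarrow> real"
  assumes S: "open S" "C2_on S f" and x: "x \<in> S"
  shows "hess f x v \<bullet> w = v \<bullet> hess f x w"
proof -
  have "hess f x v \<bullet> w = (\<Sum>k\<in>UNIV. \<Sum>l\<in>UNIV. partial l (partial k f) x * v $ l * w $ k)"
    by (simp add: hess_def inner_vec_def sum_distrib_right)
  also have "\<dots> = (\<Sum>l\<in>UNIV. \<Sum>k\<in>UNIV. partial k (partial l f) x * v $ l * w $ k)"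
    by (subst sum.swap) (simp add: partial_commute[OF S x])
  also have "\<dots> = v \<bullet> hess f x w"
    by (simp add: hess_def inner_vec_def sum_distrib_left mult_ac)
  finally show ?thesis .
qed

section \<open>Tangent spaces of level sets\<close>

lemma tangent_space_level_set_subset:
  fixes f :: "real^'n \<Rightarrow> real"
  assumes S: "open S" "C1_on S f" and x: "x \<in> S"
  shows "tangent_space (level_set S f x) x \<subseteq> {v. gradient f x \<bullet> v = 0}"
proof
  fix v assume "v \<in> tangent_space (level_set S f x) x"
  then obtain \<gamma> where \<gamma>: "\<gamma> 0 = x" "\<forall>\<^sub>F t in nhds 0. \<gamma> t \<in> level_set S f x"
    "(\<gamma> has_vector_derivative v) (at (0::real))"
    by (auto simp: tangent_space_def)
  have "(\<gamma> has_derivative (\<lambda>t. t *\<^sub>R v)) (at 0)"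
    "(f has_derivative (\<lambda>h. gradient f x \<bullet> h)) (at (\<gamma> 0))"
    using \<gamma>(1,3) C1_on_has_derivative[OF S x] by (simp_all add: has_vector_derivative_def)
  from diff_chain_at[OF this]
  have "((\<lambda>t. f (\<gamma> t)) has_derivative (\<lambda>t. gradient f x \<bullet> (t *\<^sub>R v))) (at 0)"
    by (simp only: o_def)
  moreover have "((\<lambda>t. f (\<gamma> t)) has_derivative (\<lambda>t. 0)) (at 0)"
  proof (rule has_derivative_transform_eventually[of "\<lambda>_. f x"])
    show "\<forall>\<^sub>F t in at 0. f x = f (\<gamma> t)"
      using \<gamma>(2) by (auto simp: level_set_def eventually_at_filter elim: eventually_mono)
  qed (use \<gamma>(1) in auto)
  ultimately have "(\<lambda>t. gradient f x \<bullet> (t *\<^sub>R v)) = (\<lambda>t. 0)"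
    by (rule has_derivative_unique)
  then have "gradient f x \<bullet> (1 *\<^sub>R v) = 0" by metis
  then show "v \<in> {v. gradient f x \<bullet> v = 0}" by simp
qed

text \<open>The values of \<open>f - f x\<close> at the two points at distance \<open>\<epsilon> |t| |g|\<close> from \<open>x + t v\<close> along the
  gradient \<open>g\<close> are not both positive or both negative, because \<open>f (x + t v) - f x\<close> is of order
  \<open>o(t)\<close> for \<open>v\<close> orthogonal to \<open>g\<close>. The intermediate value theorem gives a root between them.\<close>
lemma level_set_root_near_tangent:
  fixes f :: "real^'n \<Rightarrow> real"
  assumes S: "open S" "C1_on S f" and x: "x \<in> S" and g: "gradient f x \<noteq> 0"
    and v: "gradient f x \<bullet> v = 0" and d: "d > 0"
    and sub: "\<And>t s. \<bar>t\<bar> \<le> d \<Longrightarrow> \<bar>s\<bar> \<le> d \<Longrightarrow> x + t *\<^sub>R v + s *\<^sub>R gradient f x \<in> S"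
    and eps: "0 < \<epsilon>" "\<epsilon> \<le> 1"
  shows "\<exists>\<delta>>0. \<forall>t. \<bar>t\<bar> < \<delta> \<longrightarrow> (\<exists>s. \<bar>s\<bar> \<le> d \<and> \<bar>s\<bar> \<le> \<epsilon> * \<bar>t\<bar> \<and> f (x + t *\<^sub>R v + s *\<^sub>R gradient f x) = f x)"
proof -
  define g where "g = gradient f x"
  define L where "L = norm v + norm g"
  have L: "L > 0" using \<open>gradient f x \<noteq> 0\<close> by (simp add: L_def g_def add_nonneg_pos)
  \<comment> \<open>With this error bound in the definition of the derivative, the error at distance at most
    \<open>|t| L\<close> from \<open>x\<close> does not exceed the first-order change \<open>\<epsilon> |t| |g|\<^sup>2\<close> along \<open>g\<close>.\<close>
  define e where "e = \<epsilon> * (norm g)\<^sup>2 / L"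
  have e: "e > 0" using L eps assms(4) by (simp add: e_def g_def)
  have der: "(f has_derivative (\<lambda>h. g \<bullet> h)) (at x)"
    unfolding g_def by (rule C1_on_has_derivative[OF S x])
  then obtain r where r: "r > 0" "\<And>y. norm (y - x) < r \<Longrightarrow> norm (f y - f x - g \<bullet> (y - x)) \<le> e * norm (y - x)"
    using e unfolding has_derivative_at_alt by blast
  define \<delta> where "\<delta> = min d (r / L)"
  have "\<exists>s. \<bar>s\<bar> \<le> d \<and> \<bar>s\<bar> \<le> \<epsilon> * \<bar>t\<bar> \<and> f (x + t *\<^sub>R v + s *\<^sub>R g) = f x" if t: "\<bar>t\<bar> < \<delta>" for t
  proof -
    define a where "a = \<epsilon> * \<bar>t\<bar>"
    have a: "0 \<le> a" "a \<le> \<bar>t\<bar>" using eps by (auto simp: a_def mult_left_le_one_le)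
    have td: "\<bar>t\<bar> \<le> d" "\<bar>t\<bar> * L < r"
      using t L by (auto simp: \<delta>_def pos_less_divide_eq)
    have est: "\<bar>f (x + t *\<^sub>R v + s *\<^sub>R g) - f x - s * (norm g)\<^sup>2\<bar> \<le> a * (norm g)\<^sup>2" if "\<bar>s\<bar> \<le> a" for s
    proof -
      have n: "norm (t *\<^sub>R v + s *\<^sub>R g) \<le> \<bar>t\<bar> * L"
      proof -
        have "norm (t *\<^sub>R v + s *\<^sub>R g) \<le> \<bar>t\<bar> * norm v + \<bar>s\<bar> * norm g"
          by (rule norm_triangle_le) simp
        also have "\<dots> \<le> \<bar>t\<bar> * norm v + \<bar>t\<bar> * norm g"
          using that a by (intro add_left_mono mult_right_mono) auto
        finally show ?thesis by (simp add: L_def distrib_left)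
      qed
      have "norm (f (x + t *\<^sub>R v + s *\<^sub>R g) - f x - g \<bullet> (t *\<^sub>R v + s *\<^sub>R g)) \<le> e * norm (t *\<^sub>R v + s *\<^sub>R g)"
        using r(2)[of "x + t *\<^sub>R v + s *\<^sub>R g"] n td(2) by (simp add: add.assoc)
      also have "\<dots> \<le> e * (\<bar>t\<bar> * L)" using n e by (intro mult_left_mono) auto
      also have "\<dots> = a * (norm g)\<^sup>2" using L by (simp add: e_def a_def)
      finally show ?thesis using v by (simp add: g_def inner_add_right power2_norm_eq_inner)
    qed
    have "\<exists>s\<ge>-a. s \<le> a \<and> f (x + t *\<^sub>R v + s *\<^sub>R g) = f x"
    proof (rule IVT')
      show "f (x + t *\<^sub>R v + (- a) *\<^sub>R g) \<le> f x" "f x \<le> f (x + t *\<^sub>R v + a *\<^sub>R g)"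
        using est[of "-a"] est[of a] a by auto
      show "continuous_on {-a..a} (\<lambda>s. f (x + t *\<^sub>R v + s *\<^sub>R g))"
        by (rule continuous_on_compose2[OF C1_on_continuous[OF S(2)]])
           (use sub[of t] td a in \<open>auto intro!: continuous_intros simp: g_def\<close>)
    qed (use a in auto)
    then obtain s where "- a \<le> s" "s \<le> a" "f (x + t *\<^sub>R v + s *\<^sub>R g) = f x" by blast
    then show ?thesis using a td(1) by (intro exI[of _ s]) (auto simp: a_def[symmetric])
  qed
  moreover have "\<delta> > 0" using d r L by (simp add: \<delta>_def)
  ultimately show ?thesis unfolding g_def by blast
qed

text \<open>The curve with velocity \<open>v\<close> is \<open>x + t v + \<sigma>(t) g\<close>, where \<open>\<sigma>(t)\<close> is a root of smallest
  absolute value. Minimality turns the root estimates, which may find a different root for each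
  \<open>\<epsilon>\<close>, into the single statement \<open>\<sigma>(t) = o(t)\<close>.\<close>
lemma tangent_space_level_set:
  fixes f :: "real^'n \<Rightarrow> real"
  assumes S: "open S" "C1_on S f" and x: "x \<in> S" and g: "gradient f x \<noteq> 0"
  shows "tangent_space (level_set S f x) x = {v. gradient f x \<bullet> v = 0}"
proof (rule antisym[OF tangent_space_level_set_subset[OF S x]], rule subsetI)
  fix v assume "v \<in> {v. gradient f x \<bullet> v = 0}"
  then have v: "gradient f x \<bullet> v = 0" by simp
  define g where "g = gradient f x"
  obtain r where r: "r > 0" "cball x r \<subseteq> S"
    using S(1) x open_contains_cball by blast
  define d where "d = r / (norm v + norm g + 1)"
  have pos: "norm v + norm g + 1 > 0" by (simp add: add_nonneg_pos)
  have d: "d > 0" using r pos by (simp add: d_def)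
  have sub: "x + t *\<^sub>R v + s *\<^sub>R g \<in> S" if "\<bar>t\<bar> \<le> d" "\<bar>s\<bar> \<le> d" for t s
  proof -
    have "norm (t *\<^sub>R v + s *\<^sub>R g) \<le> \<bar>t\<bar> * norm v + \<bar>s\<bar> * norm g"
      by (rule norm_triangle_le) simp
    also have "\<dots> \<le> d * norm v + d * norm g"
      using that by (intro add_mono mult_right_mono) auto
    also have "\<dots> \<le> d * (norm v + norm g + 1)" using d by (simp add: distrib_left)
    also have "\<dots> = r" using pos by (simp add: d_def)
    finally have "norm (t *\<^sub>R v + s *\<^sub>R g) \<le> r" .
    moreover have "dist x (x + t *\<^sub>R v + s *\<^sub>R g) = norm (t *\<^sub>R v + s *\<^sub>R g)"
      by (metis add.assoc add_diff_cancel_left' dist_norm norm_minus_commute)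
    ultimately have "x + t *\<^sub>R v + s *\<^sub>R g \<in> cball x r" by simp
    then show ?thesis using r by auto
  qed
  define Z where "Z t = {s \<in> {-d..d}. f (x + t *\<^sub>R v + s *\<^sub>R g) = f x}" for t
  have root: "\<exists>\<delta>>0. \<forall>t. \<bar>t\<bar> < \<delta> \<longrightarrow> (\<exists>s\<in>Z t. \<bar>s\<bar> \<le> \<epsilon> * \<bar>t\<bar>)" if eps: "0 < \<epsilon>" "\<epsilon> \<le> 1" for \<epsilon>
  proof -
    obtain \<delta> where \<delta>: "\<delta> > 0" "\<And>t. \<bar>t\<bar> < \<delta> \<Longrightarrow> \<exists>s. \<bar>s\<bar> \<le> d \<and> \<bar>s\<bar> \<le> \<epsilon> * \<bar>t\<bar> \<and> f (x + t *\<^sub>R v + s *\<^sub>R g) = f x"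
      using level_set_root_near_tangent[OF S x g v d sub[unfolded g_def] eps] by (auto simp: g_def)
    have "\<exists>s\<in>Z t. \<bar>s\<bar> \<le> \<epsilon> * \<bar>t\<bar>" if t: "\<bar>t\<bar> < \<delta>" for t
    proof -
      obtain s where "\<bar>s\<bar> \<le> d" "\<bar>s\<bar> \<le> \<epsilon> * \<bar>t\<bar>" "f (x + t *\<^sub>R v + s *\<^sub>R g) = f x"
        using \<delta>(2)[OF t] by blast
      then show ?thesis by (intro bexI[of _ s]) (auto simp: Z_def abs_le_iff)
    qed
    then show ?thesis using \<delta>(1) by blast
  qed
  define \<sigma> where "\<sigma> t = (SOME s. s \<in> Z t \<and> (\<forall>s'\<in>Z t. \<bar>s\<bar> \<le> \<bar>s'\<bar>))" for t
  have \<sigma>: "\<sigma> t \<in> Z t \<and> (\<forall>s'\<in>Z t. \<bar>\<sigma> t\<bar> \<le> \<bar>s'\<bar>)" if "\<bar>t\<bar> \<le> d" "Z t \<noteq> {}" for t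
  proof -
    have cont: "continuous_on {-d..d} (\<lambda>s. f (x + t *\<^sub>R v + s *\<^sub>R g))"
      by (rule continuous_on_compose2[OF C1_on_continuous[OF S(2)]])
         (use sub[OF that(1)] in \<open>auto intro!: continuous_intros\<close>)
    have "closed (Z t)"
      unfolding Z_def by (rule continuous_closed_preimage_constant[OF cont]) simp
    moreover have "Z t \<subseteq> {-d..d}" by (auto simp: Z_def)
    ultimately have "compact (Z t)"
      by (metis compact_Icc closed_Int_compact inf.absorb_iff1)
    then have "\<exists>s\<in>Z t. \<forall>s'\<in>Z t. \<bar>s\<bar> \<le> \<bar>s'\<bar>"
      using that(2) by (rule continuous_attains_inf) (intro continuous_intros)
    then have "\<exists>s. s \<in> Z t \<and> (\<forall>s'\<in>Z t. \<bar>s\<bar> \<le> \<bar>s'\<bar>)" by blast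
    then show ?thesis unfolding \<sigma>_def by (rule someI_ex)
  qed
  have small: "\<exists>\<delta>>0. \<forall>t. \<bar>t\<bar> < \<delta> \<longrightarrow> \<sigma> t \<in> Z t \<and> \<bar>\<sigma> t\<bar> \<le> \<epsilon> * \<bar>t\<bar>" if eps: "0 < \<epsilon>" for \<epsilon>
  proof -
    have "0 < min \<epsilon> 1" "min \<epsilon> 1 \<le> 1" using eps by auto
    from root[OF this] obtain \<delta> where \<delta>: "\<delta> > 0"
      "\<And>t. \<bar>t\<bar> < \<delta> \<Longrightarrow> \<exists>s\<in>Z t. \<bar>s\<bar> \<le> min \<epsilon> 1 * \<bar>t\<bar>" by blast
    have "\<sigma> t \<in> Z t \<and> \<bar>\<sigma> t\<bar> \<le> \<epsilon> * \<bar>t\<bar>" if t: "\<bar>t\<bar> < min \<delta> d" for t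
    proof -
      obtain s where s: "s \<in> Z t" "\<bar>s\<bar> \<le> min \<epsilon> 1 * \<bar>t\<bar>" using \<delta>(2) t by auto
      note s(2)
      also have "min \<epsilon> 1 * \<bar>t\<bar> \<le> \<epsilon> * \<bar>t\<bar>" by (intro mult_right_mono) auto
      finally have "\<bar>s\<bar> \<le> \<epsilon> * \<bar>t\<bar>" .
      moreover have "\<sigma> t \<in> Z t \<and> (\<forall>s'\<in>Z t. \<bar>\<sigma> t\<bar> \<le> \<bar>s'\<bar>)"
        using t s(1) by (intro \<sigma>) auto
      ultimately show ?thesis using s(1) by (meson order_trans)
    qed
    then show ?thesis using \<delta>(1) d by (intro exI[of _ "min \<delta> d"]) auto
  qed
  have \<sigma>0: "\<sigma> 0 = 0"
  proof -
    obtain \<delta> :: real where "\<delta> > 0" "\<And>t. \<bar>t\<bar> < \<delta> \<Longrightarrow> \<bar>\<sigma> t\<bar> \<le> 1 * \<bar>t\<bar>" using small[of 1] by auto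
    from this(2)[of 0] this(1) show ?thesis by simp
  qed
  define \<gamma> where "\<gamma> t = x + t *\<^sub>R v + \<sigma> t *\<^sub>R g" for t
  have "\<gamma> 0 = x" by (simp add: \<gamma>_def \<sigma>0)
  moreover have "\<forall>\<^sub>F t in nhds 0. \<gamma> t \<in> level_set S f x"
  proof -
    obtain \<delta> where \<delta>: "\<delta> > 0" "\<And>t. \<bar>t\<bar> < \<delta> \<Longrightarrow> \<sigma> t \<in> Z t" using small[of 1] by auto
    have "\<gamma> t \<in> level_set S f x" if "dist t 0 < min \<delta> d" for t
    proof -
      have t: "\<bar>t\<bar> < \<delta>" "\<bar>t\<bar> \<le> d" using that by auto
      have "\<sigma> t \<in> Z t" by (rule \<delta>(2)[OF t(1)])
      moreover from this have "\<bar>\<sigma> t\<bar> \<le> d" by (auto simp: Z_def)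
      then have "x + t *\<^sub>R v + \<sigma> t *\<^sub>R g \<in> S" by (rule sub[OF t(2)])
      ultimately show ?thesis by (simp add: Z_def level_set_def \<gamma>_def)
    qed
    then show ?thesis using \<delta>(1) d unfolding eventually_nhds_metric
      by (intro exI[of _ "min \<delta> d"]) auto
  qed
  moreover have "(\<gamma> has_vector_derivative v) (at 0)"
    unfolding has_vector_derivative_def has_derivative_at_alt
  proof (intro conjI allI impI)
    show "bounded_linear (\<lambda>t. t *\<^sub>R v)" by (rule bounded_linear_scaleR_left)
    fix e :: real assume e: "e > 0"
    have ng: "norm g > 0" using g by (simp add: g_def)
    obtain \<delta> where \<delta>: "\<delta> > 0" "\<And>t. \<bar>t\<bar> < \<delta> \<Longrightarrow> \<bar>\<sigma> t\<bar> \<le> e / norm g * \<bar>t\<bar>"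
      using small[of "e / norm g"] e ng by auto
    have "norm (\<gamma> t - \<gamma> 0 - (t - 0) *\<^sub>R v) \<le> e * norm (t - 0)" if "norm (t - 0) < \<delta>" for t
    proof -
      have "norm (\<gamma> t - \<gamma> 0 - (t - 0) *\<^sub>R v) = \<bar>\<sigma> t\<bar> * norm g" by (simp add: \<gamma>_def \<sigma>0)
      also have "\<dots> \<le> (e / norm g * \<bar>t\<bar>) * norm g"
        using \<delta>(2)[of t] that by (intro mult_right_mono) auto
      also have "\<dots> = e * \<bar>t\<bar>" using ng by simp
      finally show ?thesis by simp
    qed
    then show "\<exists>d>0. \<forall>y. norm (y - 0) < d \<longrightarrow> norm (\<gamma> y - \<gamma> 0 - (y - 0) *\<^sub>R v) \<le> e * norm (y - 0)"
      using \<delta>(1) by blast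
  qed
  ultimately show "v \<in> tangent_space (level_set S f x) x" by (auto simp: tangent_space_def)
qed

lemma orthogonal_projection_hyperplane:
  fixes n :: "real^'n"
  assumes "norm n = 1" "T = {v. n \<bullet> v = 0}"
  shows "orthogonal_projection T w = w - (n \<bullet> w) *\<^sub>R n"
  unfolding orthogonal_projection_def
proof (rule the_equality)
  have nn: "n \<bullet> n = 1" using assms(1) by (simp add: norm_eq_1)
  then show "w - (n \<bullet> w) *\<^sub>R n \<in> T \<and> (\<forall>v\<in>T. orthogonal (w - (w - (n \<bullet> w) *\<^sub>R n)) v)"
    by (auto simp: assms(2) orthogonal_def inner_diff_right)
  fix p assume p: "p \<in> T \<and> (\<forall>v\<in>T. orthogonal (w - p) v)"
  define q where "q = w - (n \<bullet> w) *\<^sub>R n - p"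
  have nq: "n \<bullet> q = 0" using p nn by (simp add: q_def assms(2) inner_diff_right)
  then have "(w - p) \<bullet> q = 0" using p by (auto simp: assms(2) orthogonal_def)
  moreover have "w - p = q + (n \<bullet> w) *\<^sub>R n" by (simp add: q_def)
  ultimately have "q \<bullet> q = 0" using nq by (simp add: inner_add_left)
  then show "p = w - (n \<bullet> w) *\<^sub>R n" by (simp add: q_def)
qed

section \<open>Diagonalisation of self-adjoint maps\<close>

text \<open>A maximiser \<open>b\<close> of the Rayleigh quotient on the unit sphere is an eigenvector: otherwise a small
  step from \<open>b\<close> in the direction of \<open>w = A b - \<mu> b\<close> increases the quotient.\<close>
lemma self_adjoint_eigenvector_exists:
  fixes A :: "'a::euclidean_space \<Rightarrow> 'a"
  assumes T: "subspace T" "T \<noteq> {0}" and A: "linear A" "\<And>v. v \<in> T \<Longrightarrow> A v \<in> T"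
    and sym: "\<And>v w. v \<in> T \<Longrightarrow> w \<in> T \<Longrightarrow> A v \<bullet> w = v \<bullet> A w"
  shows "\<exists>b\<in>T. norm b = 1 \<and> A b = (A b \<bullet> b) *\<^sub>R b"
proof -
  have contA: "continuous_on U A" for U
    using A(1) by (rule linear_continuous_on[OF linear_conv_bounded_linear[THEN iffD1]])
  let ?C = "sphere 0 1 \<inter> T"
  obtain z where z: "z \<in> T" "z \<noteq> 0" using T subspace_0 by blast
  then have "z /\<^sub>R norm z \<in> ?C" using T(1) by (simp add: subspace_scale)
  then have "?C \<noteq> {}" by blast
  moreover have "compact ?C" by (intro compact_Int_closed compact_sphere closed_subspace T)
  ultimately have "\<exists>b\<in>?C. \<forall>y\<in>?C. A y \<bullet> y \<le> A b \<bullet> b"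
    by (intro continuous_attains_sup continuous_intros contA)
  then obtain b where b: "b \<in> T" "norm b = 1" and max: "\<And>y. y \<in> ?C \<Longrightarrow> A y \<bullet> y \<le> A b \<bullet> b"
    by auto
  define \<mu> where "\<mu> = A b \<bullet> b"
  have rayleigh: "A y \<bullet> y \<le> \<mu> * (y \<bullet> y)" if "y \<in> T" for y
  proof (cases "y = 0")
    case False
    have "A (y /\<^sub>R norm y) \<bullet> (y /\<^sub>R norm y) \<le> \<mu>"
      unfolding \<mu>_def by (rule max) (use that False T in \<open>auto simp: subspace_scale\<close>)
    then have "(A y \<bullet> y) / (norm y)\<^sup>2 \<le> \<mu>"
      by (simp add: linear_cmul[OF A(1)] power2_eq_square divide_inverse mult_ac)
    then show ?thesis using False by (simp add: divide_le_eq power2_norm_eq_inner)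
  qed (simp add: linear_0[OF A(1)])
  define w where "w = A b - \<mu> *\<^sub>R b"
  have wT: "w \<in> T" unfolding w_def by (intro subspace_diff subspace_scale T A b)
  define c where "c = A w \<bullet> w - \<mu> * (w \<bullet> w)"
  \<comment> \<open>A step so small that the first-order gain \<open>2 t |w|\<^sup>2\<close> outweighs the second-order term \<open>t\<^sup>2 c\<close>.\<close>
  define t where "t = (w \<bullet> w) / (\<bar>c\<bar> + 1)"
  have "A (b + t *\<^sub>R w) \<bullet> (b + t *\<^sub>R w) \<le> \<mu> * ((b + t *\<^sub>R w) \<bullet> (b + t *\<^sub>R w))"
    by (rule rayleigh) (intro subspace_add subspace_scale T b wT)
  moreover have "A w \<bullet> b = A b \<bullet> w" using sym[OF wT b(1)] by (simp add: inner_commute)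
  moreover have "b \<bullet> b = 1" using b by (simp add: norm_eq_1)
  moreover have "A b \<bullet> w = w \<bullet> w + \<mu> * (b \<bullet> w)" by (simp add: w_def inner_diff_left algebra_simps)
  ultimately have "2 * t * (w \<bullet> w) + t * t * c \<le> 0"
    by (simp add: linear_add[OF A(1)] linear_cmul[OF A(1)] inner_add_left inner_add_right c_def
        inner_commute[of w b] \<mu>_def[symmetric] algebra_simps)
  moreover have "w \<bullet> w = t * (\<bar>c\<bar> + 1)" by (simp add: t_def)
  ultimately have "t * t * (2 * (\<bar>c\<bar> + 1) + c) \<le> 0" by (simp add: algebra_simps)
  moreover have "2 * (\<bar>c\<bar> + 1) + c > 0" using abs_ge_minus_self[of c] abs_ge_zero[of c] by argo
  ultimately have "t * t \<le> 0" by (simp add: mult_le_0_iff)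
  then have "t = 0" by (metis antisym zero_le_square mult_eq_0_iff)
  then have "w = 0" using abs_ge_zero[of c] by (auto simp: t_def)
  then show ?thesis using b by (auto simp: w_def \<mu>_def)
qed

definition orthonormal :: "'a::euclidean_space set \<Rightarrow> bool" where
  "orthonormal B \<longleftrightarrow> pairwise orthogonal B \<and> (\<forall>b\<in>B. norm b = 1)"

lemma orthonormal_independent: "orthonormal B \<Longrightarrow> independent B"
  unfolding orthonormal_def
  by (rule pairwise_orthogonal_independent) force+

lemma orthonormal_finite: "orthonormal B \<Longrightarrow> finite B"
  using orthonormal_independent independent_bound by blast

lemma orthonormal_expansion:
  "orthonormal B \<Longrightarrow> v \<in> span B \<Longrightarrow> (\<Sum>b\<in>B. (v \<bullet> b) *\<^sub>R b) = v"
  by (rule orthonormal_basis_expand) (auto simp: orthonormal_finite, auto simp: orthonormal_def)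

lemma parseval:
  assumes "orthonormal B" "v \<in> span B"
  shows "(\<Sum>b\<in>B. (v \<bullet> b)\<^sup>2) = (norm v)\<^sup>2"
proof -
  have "(norm v)\<^sup>2 = v \<bullet> (\<Sum>b\<in>B. (v \<bullet> b) *\<^sub>R b)"
    by (simp add: orthonormal_expansion[OF assms] power2_norm_eq_inner)
  then show ?thesis by (simp add: inner_sum_right power2_eq_square)
qed

text \<open>Induction on the dimension: the orthogonal complement of an eigenvector in \<open>T\<close> is invariant
  under a self-adjoint map.\<close>
lemma self_adjoint_orthonormal_eigenbasis:
  fixes A :: "'a::euclidean_space \<Rightarrow> 'a"
  assumes "subspace T" "linear A" "\<And>v. v \<in> T \<Longrightarrow> A v \<in> T"
    "\<And>v w. v \<in> T \<Longrightarrow> w \<in> T \<Longrightarrow> A v \<bullet> w = v \<bullet> A w"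
  shows "\<exists>B. orthonormal B \<and> span B = T \<and> (\<forall>b\<in>B. A b = (A b \<bullet> b) *\<^sub>R b)"
  using assms
proof (induction "dim T" arbitrary: T rule: less_induct)
  case less
  show ?case
  proof (cases "T = {0}")
    case True
    then show ?thesis by (intro exI[of _ "{}"]) (auto simp: orthonormal_def)
  next
    case False
    then obtain b where b: "b \<in> T" "norm b = 1" "A b = (A b \<bullet> b) *\<^sub>R b"
      using self_adjoint_eigenvector_exists[of T A] less.prems by blast
    have bb: "b \<bullet> b = 1" using b by (simp add: norm_eq_1)
    define T' where "T' = T \<inter> {y. b \<bullet> y = 0}"
    have T': "subspace T'" unfolding T'_def
      by (intro subspace_inter less.prems subspace_hyperplane)
    have "b \<notin> T'" using bb by (simp add: T'_def)
    moreover have "T' \<subseteq> T" by (auto simp: T'_def)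
    ultimately have "T' \<subset> T" using b(1) by blast
    then have "dim T' < dim T"
      using dim_psubset[of T' T] T' less.prems(1) by (simp add: span_eq_iff[THEN iffD2])
    moreover have "A v \<in> T'" if "v \<in> T'" for v
    proof -
      have "b \<bullet> A v = (A b \<bullet> b) * (b \<bullet> v)"
        using less.prems(4)[of b v] b that by (metis (no_types, lifting) Int_iff T'_def inner_scaleR_left)
      then show ?thesis using that less.prems(3) by (auto simp: T'_def)
    qed
    ultimately obtain B' where B': "orthonormal B'" "span B' = T'" "\<forall>b\<in>B'. A b = (A b \<bullet> b) *\<^sub>R b"
      using less.hyps[of T'] T' less.prems(2,4) by (auto simp: T'_def)
    have orth: "b \<bullet> y = 0" if "y \<in> B'" for y
      using that B'(2) span_base[of y B'] by (auto simp: T'_def)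
    have "orthonormal (insert b B')"
      using B'(1) orth b(2) by (auto simp: orthonormal_def pairwise_insert orthogonal_def inner_commute)
    moreover have "span (insert b B') = T"
    proof
      show "span (insert b B') \<subseteq> T"
        by (rule span_minimal) (use b B'(2) span_superset[of B'] less.prems(1) in \<open>auto simp: T'_def\<close>)
      show "T \<subseteq> span (insert b B')"
      proof
        fix y assume y: "y \<in> T"
        have "y - (b \<bullet> y) *\<^sub>R b \<in> T'"
          using y b bb less.prems(1) by (auto simp: T'_def subspace_diff subspace_scale inner_diff_right)
        then show "y \<in> span (insert b B')" using B'(2) by (auto simp: span_breakdown_eq)
      qed
    qed
    ultimately show ?thesis using B'(3) b(3) by (intro exI[of _ "insert b B'"]) auto
  qed
qed

text \<open>Each eigenspace is spanned by the vectors of the eigenbasis that it contains, so counting the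
  distinct eigenvalues with the dimensions of their eigenspaces amounts to a sum over the basis.\<close>
lemma sum_eigenvalues_squared:
  fixes A :: "'a::euclidean_space \<Rightarrow> 'a"
  assumes A: "linear A" and sym: "\<And>v w. v \<in> span B \<Longrightarrow> w \<in> span B \<Longrightarrow> A v \<bullet> w = v \<bullet> A w"
    and B: "orthonormal B" "\<And>b. b \<in> B \<Longrightarrow> A b = (A b \<bullet> b) *\<^sub>R b"
  shows "(\<Sum>\<kappa>\<in>{\<kappa>. \<exists>v\<in>span B. v \<noteq> 0 \<and> A v = \<kappa> *\<^sub>R v}. real (dim {v\<in>span B. A v = \<kappa> *\<^sub>R v}) * \<kappa>\<^sup>2)
      = (\<Sum>b\<in>B. (norm (A b))\<^sup>2)"
proof -
  define ev where "ev b = A b \<bullet> b" for b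
  have ev: "A b = ev b *\<^sub>R b" if "b \<in> B" for b using B(2)[OF that] by (simp add: ev_def)
  have nb: "norm b = 1" if "b \<in> B" for b using B(1) that by (auto simp: orthonormal_def)
  have eigenspace: "{v\<in>span B. A v = \<kappa> *\<^sub>R v} = span {b\<in>B. ev b = \<kappa>}" for \<kappa>
  proof (intro antisym subsetI)
    fix v assume v: "v \<in> {v\<in>span B. A v = \<kappa> *\<^sub>R v}"
    have "v \<bullet> b = 0" if "b \<in> B" "ev b \<noteq> \<kappa>" for b
    proof -
      have "\<kappa> * (v \<bullet> b) = ev b * (v \<bullet> b)"
        using sym[of v b] v ev[OF that(1)] span_base[OF that(1)] by simp
      then show ?thesis using that(2) by simp
    qed
    then have "(\<Sum>b\<in>B. (v \<bullet> b) *\<^sub>R b) = (\<Sum>b\<in>{b\<in>B. ev b = \<kappa>}. (v \<bullet> b) *\<^sub>R b)"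
      by (intro sum.mono_neutral_right orthonormal_finite B) auto
    then have "v = (\<Sum>b\<in>{b\<in>B. ev b = \<kappa>}. (v \<bullet> b) *\<^sub>R b)"
      using orthonormal_expansion[OF B(1)] v by simp
    also have "\<dots> \<in> span {b\<in>B. ev b = \<kappa>}"
      by (intro span_sum span_scale span_base)
    finally show "v \<in> span {b\<in>B. ev b = \<kappa>}" .
  next
    fix v assume v: "v \<in> span {b\<in>B. ev b = \<kappa>}"
    then have "v \<in> span B" using span_mono[of "{b\<in>B. ev b = \<kappa>}" B] by auto
    moreover have "A v = \<kappa> *\<^sub>R v"
      using v
    proof (rule linear_eq_on_span[OF A linear_scale_self, rotated])
      show "A b = \<kappa> *\<^sub>R b" if "b \<in> {b\<in>B. ev b = \<kappa>}" for b using that ev by auto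
    qed
    ultimately show "v \<in> {v\<in>span B. A v = \<kappa> *\<^sub>R v}" by simp
  qed
  have dim: "dim {v\<in>span B. A v = \<kappa> *\<^sub>R v} = card {b\<in>B. ev b = \<kappa>}" for \<kappa>
  proof -
    have "independent {b\<in>B. ev b = \<kappa>}"
      using orthonormal_independent[OF B(1)] by (rule independent_mono) auto
    then show ?thesis unfolding eigenspace by (simp add: dim_eq_card_independent)
  qed
  have vals: "{\<kappa>. \<exists>v\<in>span B. v \<noteq> 0 \<and> A v = \<kappa> *\<^sub>R v} = ev ` B"
  proof (intro antisym subsetI)
    fix \<kappa> assume "\<kappa> \<in> {\<kappa>. \<exists>v\<in>span B. v \<noteq> 0 \<and> A v = \<kappa> *\<^sub>R v}"
    then obtain v where "v \<noteq> 0" "v \<in> span {b\<in>B. ev b = \<kappa>}" using eigenspace by blast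
    then have "{b\<in>B. ev b = \<kappa>} \<noteq> {}" by (metis singletonD span_empty)
    then show "\<kappa> \<in> ev ` B" by auto
  next
    fix \<kappa> assume "\<kappa> \<in> ev ` B"
    then obtain b where b: "b \<in> B" "\<kappa> = ev b" by auto
    then have "b \<noteq> 0" using nb by force
    then show "\<kappa> \<in> {\<kappa>. \<exists>v\<in>span B. v \<noteq> 0 \<and> A v = \<kappa> *\<^sub>R v}"
      using b ev span_base by blast
  qed
  have "(\<Sum>b\<in>B. (norm (A b))\<^sup>2) = (\<Sum>b\<in>B. (ev b)\<^sup>2)"
    by (intro sum.cong refl) (simp add: ev nb)
  also have "\<dots> = (\<Sum>\<kappa>\<in>ev ` B. \<Sum>b\<in>{b\<in>B. ev b = \<kappa>}. (ev b)\<^sup>2)"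
    by (rule sum.image_gen[OF orthonormal_finite[OF B(1)]])
  also have "\<dots> = (\<Sum>\<kappa>\<in>ev ` B. real (card {b\<in>B. ev b = \<kappa>}) * \<kappa>\<^sup>2)"
    by (intro sum.cong refl) simp
  finally show ?thesis unfolding vals dim by simp
qed


section \<open>The geometric identity\<close>

text \<open>The squared Frobenius norm of the second derivative.\<close>
definition hess_norm_sq :: "(real^'n \<Rightarrow> real) \<Rightarrow> real^'n \<Rightarrow> real" where
  "hess_norm_sq f x = (\<Sum>k\<in>UNIV. (norm (gradient (partial k f) x))\<^sup>2)"

lemma norm_squared_vec: "(norm (v :: real^'n))\<^sup>2 = (\<Sum>k\<in>UNIV. (v $ k)\<^sup>2)"
  by (simp add: norm_vec_def L2_set_def sum_nonneg)

lemma sum_hess_orthonormal_basis: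
  fixes f :: "real^'n \<Rightarrow> real"
  assumes "orthonormal B" "span B = UNIV"
  shows "(\<Sum>b\<in>B. (norm (hess f x b))\<^sup>2) = hess_norm_sq f x"
proof -
  have "(\<Sum>b\<in>B. (norm (hess f x b))\<^sup>2) = (\<Sum>b\<in>B. \<Sum>k\<in>UNIV. (gradient (partial k f) x \<bullet> b)\<^sup>2)"
    by (simp only: norm_squared_vec hess_def vec_lambda_beta)
  also have "\<dots> = (\<Sum>k\<in>UNIV. \<Sum>b\<in>B. (gradient (partial k f) x \<bullet> b)\<^sup>2)"
    by (rule sum.swap)
  also have "\<dots> = hess_norm_sq f x"
    by (simp add: parseval assms hess_norm_sq_def)
  finally show ?thesis .
qed

lemma norm_unit_normal: "gradient f x \<noteq> 0 \<Longrightarrow> norm (unit_normal f x) = 1"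
  by (simp add: unit_normal_def)

lemma norm_gradient_has_derivative:
  fixes f :: "real^'n \<Rightarrow> real"
  assumes S: "open S" "C2_on S f" "x \<in> S" and g: "gradient f x \<noteq> 0"
  shows "((\<lambda>y. norm (gradient f y)) has_derivative (\<lambda>v. hess f x (unit_normal f x) \<bullet> v)) (at x)"
proof -
  have "((\<lambda>y. norm (gradient f y)) has_derivative (\<lambda>v. hess f x v \<bullet> sgn (gradient f x))) (at x)"
    using diff_chain_at[OF gradient_has_derivative_hess[OF S] has_derivative_norm[OF g]]
    by (simp only: o_def)
  moreover have "hess f x v \<bullet> sgn (gradient f x) = hess f x (unit_normal f x) \<bullet> v" for v
    by (metis hess_symmetric[OF S] inner_commute sgn_div_norm unit_normal_def)
  ultimately show ?thesis by simp
qed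

lemma unit_normal_has_derivative:
  fixes f :: "real^'n \<Rightarrow> real"
  assumes S: "open S" "C2_on S f" "x \<in> S" and g: "gradient f x \<noteq> 0"
  defines "n \<equiv> unit_normal f x"
  shows "(unit_normal f has_derivative
      (\<lambda>v. (hess f x v - (n \<bullet> hess f x v) *\<^sub>R n) /\<^sub>R norm (gradient f x))) (at x)"
proof -
  let ?g = "gradient f x"
  have "((\<lambda>y. inverse (norm (gradient f y)) *\<^sub>R gradient f y) has_derivative
      (\<lambda>v. inverse (norm ?g) *\<^sub>R hess f x v
        + (- (inverse (norm ?g) * (hess f x n \<bullet> v) * inverse (norm ?g))) *\<^sub>R ?g)) (at x)"
    unfolding n_def
    by (rule has_derivative_scaleR[OF Deriv.has_derivative_inverse[OF _ norm_gradient_has_derivative[OF S g]]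
         gradient_has_derivative_hess[OF S]]) (use g in simp)
  moreover have "inverse (norm ?g) *\<^sub>R hess f x v
        + (- (inverse (norm ?g) * (hess f x n \<bullet> v) * inverse (norm ?g))) *\<^sub>R ?g
      = (hess f x v - (n \<bullet> hess f x v) *\<^sub>R n) /\<^sub>R norm ?g" for v
  proof -
    have "hess f x n \<bullet> v = n \<bullet> hess f x v" by (rule hess_symmetric[OF S])
    moreover have "n = inverse (norm ?g) *\<^sub>R ?g" by (simp add: n_def unit_normal_def)
    ultimately show ?thesis by (simp add: scaleR_diff_right mult_ac)
  qed
  ultimately show ?thesis by (simp add: unit_normal_def[abs_def])
qed

text \<open>Take an orthonormal basis that consists of the normal \<open>n\<close> and a basis \<open>B\<close> of the tangent space
  diagonalising the shape operator. The principal curvatures account for the tangential block of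
  \<open>D\<^sup>2f\<close>, and the tangential gradient of \<open>|\<nabla>f|\<close> is the tangential part of the column \<open>D\<^sup>2f n\<close>. By
  symmetry this part occurs twice among the entries of \<open>D\<^sup>2f\<close>, once as part of a row and once as
  part of a column, and removing the column \<open>D\<^sup>2f n\<close> leaves one copy.\<close>
lemma curvature_identity:
  fixes f :: "real^'n \<Rightarrow> real"
  assumes S: "open S" "C2_on S f" "x \<in> S" and g: "gradient f x \<noteq> 0"
  shows "(norm (gradient f x))\<^sup>2 * sum_sq_curvatures S f x
      + (norm (tangential_gradient (level_set S f x) (\<lambda>y. norm (gradient f y)) x))\<^sup>2
    = hess_norm_sq f x - (norm (hess f x (unit_normal f x)))\<^sup>2"
proof -
  define n where "n = unit_normal f x"
  have n1: "norm n = 1" and nn: "n \<bullet> n = 1"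
    using norm_unit_normal[OF g] by (simp_all add: n_def norm_eq_1)
  define T where "T = {v. n \<bullet> v = 0}"
  have T: "tangent_space (level_set S f x) x = T"
    using tangent_space_level_set[OF S(1) C2_onD(1)[OF S(2)] S(3) g] g
    by (simp add: T_def n_def unit_normal_def)
  define P where "P w = w - (n \<bullet> w) *\<^sub>R n" for w
  have P: "n \<bullet> P w = 0" "(norm (P w))\<^sup>2 = (norm w)\<^sup>2 - (n \<bullet> w)\<^sup>2" for w
    unfolding P_def power2_norm_eq_inner
    by (simp_all add: inner_diff_right inner_diff_left nn inner_commute[of w n] power2_eq_square)
  define A where "A = shape_operator (unit_normal f) x"
  have A_eq: "A v = - (P (hess f x v) /\<^sub>R norm (gradient f x))" for v
    using fun_cong[OF frechet_derivative_at[OF unit_normal_has_derivative[OF S g]], of v]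
    by (simp only: A_def shape_operator_def P_def n_def)
  have linA: "linear A"
    by (rule linearI)
       (simp_all add: A_eq P_def linear_add[OF linear_hess] linear_cmul[OF linear_hess]
         inner_add_right algebra_simps)
  have A_T: "A v \<in> T" for v by (simp add: A_eq T_def P)
  have A_sym: "A v \<bullet> w = v \<bullet> A w" if "v \<in> T" "w \<in> T" for v w
    using that by (simp add: A_eq P_def T_def inner_diff_left inner_diff_right inner_commute[of _ n]
        hess_symmetric[OF S])
  have "subspace T" unfolding T_def by (rule subspace_hyperplane)
  then obtain B where B: "orthonormal B" "span B = T" "\<forall>b\<in>B. A b = (A b \<bullet> b) *\<^sub>R b"
    using self_adjoint_orthonormal_eigenbasis[OF _ linA A_T A_sym] by blast
  have nB: "n \<bullet> b = 0" if "b \<in> B" for b using B(2) span_base[OF that] by (auto simp: T_def)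
  have n_notin: "n \<notin> B" using nB nn by force
  have ext: "orthonormal (insert n B)"
    using B(1) nB n1 by (auto simp: orthonormal_def pairwise_insert orthogonal_def inner_commute)
  have "w \<in> span (insert n B)" for w
  proof -
    have "w - (n \<bullet> w) *\<^sub>R n \<in> span B" using P(1)[of w] by (simp add: B(2) T_def P_def)
    then show ?thesis by (auto simp: span_breakdown_eq)
  qed
  then have span: "span (insert n B) = UNIV" by blast
  define c where "c = norm (gradient f x)"
  have c: "c > 0" using g by (simp add: c_def)
  have "sum_sq_curvatures S f x = (\<Sum>b\<in>B. (norm (A b))\<^sup>2)"
    using sum_eigenvalues_squared[OF linA _ B(1)] A_sym B(2,3)
    by (simp add: sum_sq_curvatures_def Let_def principal_curvatures_def curvature_multiplicity_def
        T A_def)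
  also have "\<dots> = (\<Sum>b\<in>B. ((norm (hess f x b))\<^sup>2 - (n \<bullet> hess f x b)\<^sup>2) / c\<^sup>2)"
    by (simp add: A_eq P(2)[symmetric] c_def power_mult_distrib divide_inverse power_inverse mult.commute)
  finally have "c\<^sup>2 * sum_sq_curvatures S f x
      = (\<Sum>b\<in>B. (norm (hess f x b))\<^sup>2) - (\<Sum>b\<in>B. (hess f x n \<bullet> b)\<^sup>2)"
    using c by (simp add: sum_divide_distrib[symmetric] sum_subtractf hess_symmetric[OF S])
  moreover have "hess_norm_sq f x = (norm (hess f x n))\<^sup>2 + (\<Sum>b\<in>B. (norm (hess f x b))\<^sup>2)"
    using sum_hess_orthonormal_basis[OF ext span, of f x] n_notin orthonormal_finite[OF B(1)] by simp
  moreover have "(norm (hess f x n))\<^sup>2 = (hess f x n \<bullet> n)\<^sup>2 + (\<Sum>b\<in>B. (hess f x n \<bullet> b)\<^sup>2)"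
    using parseval[OF ext, of "hess f x n"] span n_notin orthonormal_finite[OF B(1)] by simp
  moreover have "tangential_gradient (level_set S f x) (\<lambda>y. norm (gradient f y)) x = P (hess f x n)"
    using orthogonal_projection_hyperplane[OF n1 T_def] gradient_eq[OF norm_gradient_has_derivative[OF S g]]
    by (simp add: tangential_gradient_def T P_def n_def)
  ultimately show ?thesis
    using P(2)[of "hess f x n"] by (simp add: c_def n_def inner_commute)
qed

section \<open>The linearised equation\<close>

lemma integrable_continuous_compact:
  fixes g :: "real^'n \<Rightarrow> real"
  assumes "continuous_on S g" "compact K" "K \<subseteq> S" "\<And>x. x \<notin> K \<Longrightarrow> g x = 0"
  shows "integrable lborel g"
  using assms by (intro integrable_compactly_supported[of K]) (auto intro: continuous_on_subset)

lemma C1_compact_support_continuous: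
  assumes "C1_compact_support S \<phi>"
  shows "continuous_on T \<phi>" "continuous_on T (gradient \<phi>)" "continuous_on T (partial k \<phi>)"
  using C1_compact_supportD(1)[OF assms] C1_on_subset[of UNIV \<phi> T]
  by (auto intro: C1_on_continuous C1_on_continuous_gradient C1_on_continuous_partial)

text \<open>This is the equation \<open>\<Delta> (\<partial>\<^sub>k f) = \<partial>\<^sub>k G\<close> in weak form; the third derivatives of \<open>f\<close> need not
  exist. Exchanging directions in \<open>\<integral> \<partial>\<^sub>k \<partial>\<^sub>l f \<partial>\<^sub>l \<phi>\<close> produces the Laplacian of \<open>f\<close>, which equals
  \<open>G\<close> and can be differentiated again.\<close>
lemma weak_linearized_equation:
  fixes f :: "real^'n \<Rightarrow> real"
  assumes S: "open S" "C2_on S f" and G: "C1_on S G" "\<And>x. x \<in> S \<Longrightarrow> laplacian f x = G x"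
    and phi: "C1_compact_support S \<phi>"
  shows "(LINT x|lborel. gradient (partial k f) x \<bullet> gradient \<phi> x) = - (LINT x|lborel. partial k G x * \<phi> x)"
proof -
  define K where "K = closure {x. \<phi> x \<noteq> 0}"
  note D = C1_compact_supportD[OF phi, folded K_def]
  have phi0: "partial j \<phi> x = 0" "gradient \<phi> x = 0" if "x \<notin> K" for x j
    using that partial_zero_off_support gradient_zero_off_support by (auto simp: K_def)
  have cont2: "continuous_on S (partial i (partial j f))" for i j
    by (rule C1_on_continuous_partial[OF C2_onD(2)[OF S(2)]])
  have int: "integrable lborel (\<lambda>x. partial i (partial j f) x * partial l \<phi> x)" for i j l
    by (rule integrable_continuous_compact[OF _ D(2,3)])
       (auto simp: phi0 intro!: continuous_intros cont2 C1_compact_support_continuous[OF phi])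
  have "gradient (partial k f) x \<bullet> gradient \<phi> x
      = (\<Sum>l\<in>UNIV. partial k (partial l f) x * partial l \<phi> x)" for x
  proof (cases "x \<in> K")
    case True
    then have "x \<in> S" using D by auto
    then show ?thesis by (simp add: inner_vec_def partial_commute[OF S, of x k])
  qed (simp add: phi0)
  then have "(LINT x|lborel. gradient (partial k f) x \<bullet> gradient \<phi> x)
      = (\<Sum>l\<in>UNIV. LINT x|lborel. partial k (partial l f) x * partial l \<phi> x)"
    by (simp add: Bochner_Integration.integral_sum int)
  also have "\<dots> = (\<Sum>l\<in>UNIV. LINT x|lborel. partial l (partial l f) x * partial k \<phi> x)"
    by (intro sum.cong refl integral_partial_swap[OF S(1) C2_onD(2)[OF S(2)] phi])
  also have "\<dots> = (LINT x|lborel. (\<Sum>l\<in>UNIV. partial l (partial l f) x * partial k \<phi> x))"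
    by (simp add: Bochner_Integration.integral_sum int)
  also have "\<dots> = (LINT x|lborel. G x * partial k \<phi> x)"
  proof (rule Bochner_Integration.integral_cong[OF refl])
    fix x
    show "(\<Sum>l\<in>UNIV. partial l (partial l f) x * partial k \<phi> x) = G x * partial k \<phi> x"
    proof (cases "x \<in> K")
      case True
      then have "x \<in> S" using D by auto
      then show ?thesis using G(2)[of x] by (simp add: laplacian_def flip: sum_distrib_right)
    qed (simp add: phi0)
  qed
  also have "\<dots> = - (LINT x|lborel. partial k G x * \<phi> x)"
    using integral_by_parts[OF S(1) G(1) phi, of k] by simp
  finally show ?thesis .
qed

lemma continuous_on_hess_norm_sq: "C2_on S f \<Longrightarrow> continuous_on S (hess_norm_sq f)"
  unfolding hess_norm_sq_def
  by (intro continuous_intros C1_on_continuous_gradient C2_onD)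

lemma continuous_on_hess:
  "C2_on S f \<Longrightarrow> continuous_on T v \<Longrightarrow> T \<subseteq> S \<Longrightarrow> continuous_on T (\<lambda>x. hess f x (v x))"
  unfolding hess_def
  by (intro continuous_on_vec_lambda continuous_intros
      continuous_on_subset[OF C1_on_continuous_gradient[OF C2_onD(2)]])

text \<open>The linearised equation for \<open>\<partial>\<^sub>k f\<close> is tested with \<open>\<partial>\<^sub>k f \<eta>\<^sup>2\<close>, and the results are summed
  over \<open>k\<close>.\<close>
lemma linearized_energy_identity:
  fixes f :: "real^'n \<Rightarrow> real"
  assumes S: "open S" "C2_on S f" and G: "C1_on S G" "\<And>x. x \<in> S \<Longrightarrow> laplacian f x = G x"
    and eta: "C1_compact_support S \<eta>"
  shows "(LINT x|lborel. hess_norm_sq f x * (\<eta> x)\<^sup>2 + 2 * \<eta> x * (hess f x (gradient f x) \<bullet> gradient \<eta> x))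
      = - (LINT x|lborel. (gradient G x \<bullet> gradient f x) * (\<eta> x)\<^sup>2)"
proof -
  define K where "K = closure {x. \<eta> x \<noteq> 0}"
  note D = C1_compact_supportD[OF eta, folded K_def]
  have eta0: "\<eta> x = 0" "gradient \<eta> x = 0" if "x \<notin> K" for x
    using that eq_zero_off_support gradient_zero_off_support by (auto simp: K_def)
  note cont = C1_on_continuous_gradient[OF C2_onD(2)[OF S(2)]] C1_on_continuous_gradient[OF C2_onD(1)[OF S(2)]]
    C1_on_continuous_partial[OF C2_onD(1)[OF S(2)]] C1_on_continuous_gradient[OF G(1)]
    C1_on_continuous_partial[OF G(1)] C1_compact_support_continuous[OF eta]
  define \<phi> where "\<phi> k x = partial k f x * \<eta> x * \<eta> x" for k x
  have C1eta: "C1_on S \<eta>" using D(1) C1_on_subset by blast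
  have phi: "C1_compact_support S (\<phi> k)" for k
    unfolding \<phi>_def
    by (intro C1_compact_support_mult C1_on_mult S eta C2_onD C1eta)
  have grad_phi: "gradient (\<phi> k) x = (\<eta> x)\<^sup>2 *\<^sub>R gradient (partial k f) x + (2 * \<eta> x * partial k f x) *\<^sub>R gradient \<eta> x" for k x
  proof (cases "x \<in> K")
    case True
    then have x: "x \<in> S" using D by auto
    have "gradient (\<phi> k) x = (partial k f x * \<eta> x) *\<^sub>R gradient \<eta> x
        + \<eta> x *\<^sub>R gradient (\<lambda>x. partial k f x * \<eta> x) x"
      unfolding \<phi>_def by (intro gradient_mult[OF S(1)] C1_on_mult S C2_onD C1eta x)
    also have "gradient (\<lambda>x. partial k f x * \<eta> x) x = partial k f x *\<^sub>R gradient \<eta> x + \<eta> x *\<^sub>R gradient (partial k f) x"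
      by (intro gradient_mult[OF S(1)] S C2_onD C1eta x)
    finally show ?thesis by (simp add: power2_eq_square algebra_simps flip: scaleR_add_left)
  next
    case False
    have "{x. \<phi> k x \<noteq> 0} \<subseteq> {x. \<eta> x \<noteq> 0}" by (auto simp: \<phi>_def)
    then have "x \<notin> closure {x. \<phi> k x \<noteq> 0}" using False closure_mono by (auto simp: K_def)
    from gradient_zero_off_support[OF this] show ?thesis using eta0[OF False] by simp
  qed
  have int1: "integrable lborel (\<lambda>x. gradient (partial k f) x \<bullet> gradient (\<phi> k) x)" for k
    unfolding grad_phi
    by (rule integrable_continuous_compact[OF _ D(2,3)])
       (auto simp: eta0 intro!: continuous_intros cont)
  have int2: "integrable lborel (\<lambda>x. partial k G x * \<phi> k x)" for k
    unfolding \<phi>_def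
    by (rule integrable_continuous_compact[OF _ D(2,3)])
       (auto simp: eta0 intro!: continuous_intros cont)
  have "hess_norm_sq f x * (\<eta> x)\<^sup>2 + 2 * \<eta> x * (hess f x (gradient f x) \<bullet> gradient \<eta> x)
      = (\<Sum>k\<in>UNIV. gradient (partial k f) x \<bullet> gradient (\<phi> k) x)" for x
  proof (cases "x \<in> K")
    case True
    then have x: "x \<in> S" using D by auto
    have "hess f x (gradient f x) \<bullet> gradient \<eta> x = hess f x (gradient \<eta> x) \<bullet> gradient f x"
      by (metis hess_symmetric[OF S x] inner_commute)
    also have "\<dots> = (\<Sum>k\<in>UNIV. (gradient (partial k f) x \<bullet> gradient \<eta> x) * partial k f x)"
      by (subst inner_vec_def) (simp add: hess_def)
    finally show ?thesis
      by (simp only: grad_phi hess_norm_sq_def)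
         (simp add: inner_add_right sum.distrib sum_distrib_right sum_distrib_left power2_norm_eq_inner mult_ac)
  qed (simp add: eta0 grad_phi)
  then have "(LINT x|lborel. hess_norm_sq f x * (\<eta> x)\<^sup>2 + 2 * \<eta> x * (hess f x (gradient f x) \<bullet> gradient \<eta> x))
      = (\<Sum>k\<in>UNIV. LINT x|lborel. gradient (partial k f) x \<bullet> gradient (\<phi> k) x)"
    by (simp add: Bochner_Integration.integral_sum int1)
  also have "\<dots> = (\<Sum>k\<in>UNIV. - (LINT x|lborel. partial k G x * \<phi> k x))"
    by (intro sum.cong refl weak_linearized_equation[OF S G phi])
  also have "\<dots> = - (LINT x|lborel. (\<Sum>k\<in>UNIV. partial k G x * \<phi> k x))"
    by (simp add: Bochner_Integration.integral_sum int2 sum_negf)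
  also have "(\<lambda>x. \<Sum>k\<in>UNIV. partial k G x * \<phi> k x) = (\<lambda>x. (gradient G x \<bullet> gradient f x) * (\<eta> x)\<^sup>2)"
    by (simp add: \<phi>_def inner_vec_def sum_distrib_right sum_distrib_left power2_eq_square mult_ac)
  finally show ?thesis .
qed

section \<open>The regularised test functions\<close>

text \<open>Stability may be tested only with \<open>C\<^sup>1\<close> functions, and the norm is not differentiable at zero.\<close>
definition reg_norm :: "real \<Rightarrow> 'a::real_normed_vector \<Rightarrow> real" where
  "reg_norm \<epsilon> v = sqrt ((norm v)\<^sup>2 + \<epsilon>)"

lemma reg_norm_pos: "\<epsilon> > 0 \<Longrightarrow> reg_norm \<epsilon> v > 0"
  by (simp add: reg_norm_def add_nonneg_pos)

lemma reg_norm_sq: "\<epsilon> > 0 \<Longrightarrow> (reg_norm \<epsilon> v)\<^sup>2 = (norm v)\<^sup>2 + \<epsilon>"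
  by (simp add: reg_norm_def)

lemma continuous_on_reg_norm [continuous_intros]:
  "continuous_on S g \<Longrightarrow> continuous_on S (\<lambda>x. reg_norm \<epsilon> (g x))"
  unfolding reg_norm_def by (intro continuous_intros)

lemma reg_norm_gradient_has_derivative:
  fixes f :: "real^'n \<Rightarrow> real"
  assumes S: "open S" "C2_on S f" "x \<in> S" and eps: "\<epsilon> > 0"
  shows "((\<lambda>y. reg_norm \<epsilon> (gradient f y)) has_derivative
      (\<lambda>v. (hess f x (gradient f x) /\<^sub>R reg_norm \<epsilon> (gradient f x)) \<bullet> v)) (at x)"
proof -
  have sq: "((\<lambda>y. gradient f y \<bullet> gradient f y + \<epsilon>) has_derivative
      (\<lambda>v. gradient f x \<bullet> hess f x v + hess f x v \<bullet> gradient f x)) (at x)"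
    by (intro has_derivative_add_const has_derivative_inner gradient_has_derivative_hess[OF S])
  have pos: "gradient f x \<bullet> gradient f x + \<epsilon> > 0" using eps by (simp add: add_nonneg_pos)
  have "gradient f x \<bullet> hess f x v + hess f x v \<bullet> gradient f x = 2 * (hess f x (gradient f x) \<bullet> v)" for v
    using hess_symmetric[OF S, of "gradient f x" v] by (simp add: inner_commute)
  then show ?thesis
    using has_derivative_real_sqrt[OF pos sq]
    by (simp add: reg_norm_def[abs_def] power2_norm_eq_inner mult.commute)
qed

lemma C1_on_reg_norm_gradient:
  fixes f :: "real^'n \<Rightarrow> real"
  assumes S: "open S" "C2_on S f" and eps: "\<epsilon> > 0"
  shows "C1_on S (\<lambda>y. reg_norm \<epsilon> (gradient f y))"
proof (rule C1_onI[OF reg_norm_gradient_has_derivative[OF S _ eps]])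
  have "reg_norm \<epsilon> v \<noteq> 0" for v :: "real^'n"
    using reg_norm_pos[OF eps, of v] by linarith
  then show "continuous_on S (\<lambda>x. hess f x (gradient f x) /\<^sub>R reg_norm \<epsilon> (gradient f x))"
    by (intro continuous_intros continuous_on_hess[OF S(2)] C1_on_continuous_gradient C2_onD[OF S(2)])
       auto
qed

text \<open>The cross term does not depend on \<open>\<epsilon>\<close>, since \<open>w \<nabla>w = D\<^sup>2f \<nabla>f\<close> for the regularised norm \<open>w\<close> of
  the gradient. It is therefore exactly the cross term of the linearised energy identity.\<close>
lemma norm_gradient_test_function:
  fixes f :: "real^'n \<Rightarrow> real"
  assumes S: "open S" "C2_on S f" and eta: "C1_on S \<eta>" and x: "x \<in> S" and eps: "\<epsilon> > 0"
  shows "(norm (gradient (\<lambda>y. reg_norm \<epsilon> (gradient f y) * \<eta> y) x))\<^sup>2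
    = ((norm (gradient f x))\<^sup>2 + \<epsilon>) * (norm (gradient \<eta> x))\<^sup>2
      + 2 * \<eta> x * (hess f x (gradient f x) \<bullet> gradient \<eta> x)
      + (norm (hess f x (gradient f x)))\<^sup>2 / ((norm (gradient f x))\<^sup>2 + \<epsilon>) * (\<eta> x)\<^sup>2"
proof -
  define w where "w = reg_norm \<epsilon> (gradient f x)"
  define h where "h = hess f x (gradient f x)"
  have w: "w > 0" "w\<^sup>2 = (norm (gradient f x))\<^sup>2 + \<epsilon>"
    using eps by (auto simp: w_def reg_norm_pos reg_norm_sq)
  have "gradient (\<lambda>y. reg_norm \<epsilon> (gradient f y)) x = h /\<^sub>R w"
    unfolding w_def h_def by (rule gradient_eq[OF reg_norm_gradient_has_derivative[OF S x eps]])
  then have "gradient (\<lambda>y. reg_norm \<epsilon> (gradient f y) * \<eta> y) x = w *\<^sub>R gradient \<eta> x + (\<eta> x / w) *\<^sub>R h"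
    by (subst gradient_mult[OF S(1) C1_on_reg_norm_gradient[OF S eps] eta x])
       (simp add: w_def divide_inverse)
  then have "(norm (gradient (\<lambda>y. reg_norm \<epsilon> (gradient f y) * \<eta> y) x))\<^sup>2
      = w\<^sup>2 * (gradient \<eta> x \<bullet> gradient \<eta> x) + 2 * (w * (\<eta> x / w)) * (h \<bullet> gradient \<eta> x) + (\<eta> x / w)\<^sup>2 * (h \<bullet> h)"
    by (simp only: power2_norm_eq_inner)
       (simp add: inner_add_left inner_add_right inner_commute power2_eq_square algebra_simps)
  also have "\<dots> = w\<^sup>2 * (norm (gradient \<eta> x))\<^sup>2 + 2 * \<eta> x * (h \<bullet> gradient \<eta> x) + (norm h)\<^sup>2 / w\<^sup>2 * (\<eta> x)\<^sup>2"
    using w(1) by (simp add: power2_norm_eq_inner power_divide)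
  finally show ?thesis by (simp add: w(2) h_def)
qed

definition curvature_density :: "(real^'n) set \<Rightarrow> (real^'n \<Rightarrow> real) \<Rightarrow> real^'n \<Rightarrow> real" where
  "curvature_density S f x = (norm (gradient f x))\<^sup>2 * sum_sq_curvatures S f x
      + (norm (tangential_gradient (level_set S f x) (\<lambda>y. norm (gradient f y)) x))\<^sup>2"

lemma curvature_density_nonneg: "0 \<le> curvature_density S f x"
  unfolding curvature_density_def sum_sq_curvatures_def Let_def
  by (intro add_nonneg_nonneg mult_nonneg_nonneg sum_nonneg) auto

lemma hess_norm_sq_nonneg: "0 \<le> hess_norm_sq f x"
  unfolding hess_norm_sq_def by (intro sum_nonneg) auto

text \<open>For \<open>\<nabla>f \<noteq> 0\<close> the left side is at most \<open>|D\<^sup>2f n|\<^sup>2\<close>, and the curvature identity applies. At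
  critical points the left side is zero.\<close>
lemma reg_hess_le:
  fixes f :: "real^'n \<Rightarrow> real"
  assumes S: "open S" "C2_on S f" "x \<in> S" and eps: "\<epsilon> > 0"
  shows "(norm (hess f x (gradient f x)))\<^sup>2 / ((norm (gradient f x))\<^sup>2 + \<epsilon>)
    \<le> hess_norm_sq f x - indicator {x\<in>S. gradient f x \<noteq> 0} x * curvature_density S f x"
proof (cases "gradient f x = 0")
  case True
  then show ?thesis using hess_norm_sq_nonneg[of f x] by (simp add: linear_0[OF linear_hess])
next
  case False
  let ?c = "norm (gradient f x)" and ?n = "unit_normal f x"
  have "gradient f x = ?c *\<^sub>R ?n" using False by (simp add: unit_normal_def)
  then have "norm (hess f x (gradient f x)) = ?c * norm (hess f x ?n)"
    by (metis abs_norm_cancel linear_cmul[OF linear_hess] norm_scaleR)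
  then have "(norm (hess f x (gradient f x)))\<^sup>2 = ?c\<^sup>2 * (norm (hess f x ?n))\<^sup>2"
    by (simp add: power_mult_distrib)
  also have "\<dots> \<le> (norm (hess f x ?n))\<^sup>2 * (?c\<^sup>2 + \<epsilon>)"
    using eps by (simp add: algebra_simps)
  finally have "(norm (hess f x (gradient f x)))\<^sup>2 / (?c\<^sup>2 + \<epsilon>) \<le> (norm (hess f x ?n))\<^sup>2"
    using eps by (simp add: divide_le_eq add_nonneg_pos)
  also have "\<dots> = hess_norm_sq f x - curvature_density S f x"
    using curvature_identity[OF S False] by (simp add: curvature_density_def)
  finally show ?thesis using False S(3) by simp
qed

text \<open>Measurability of the curvature terms is not visible from their definition. The curvature
  identity shows that they are continuous on the open set \<open>{\<nabla>f \<noteq> 0}\<close> and dominated by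
  \<open>|D\<^sup>2f|\<^sup>2\<close>.\<close>
lemma integrable_curvature_density:
  fixes f :: "real^'n \<Rightarrow> real"
  assumes S: "open S" "C2_on S f" and eta: "C1_compact_support S \<eta>"
  shows "integrable lborel (\<lambda>x. indicator {x\<in>S. gradient f x \<noteq> 0} x * (curvature_density S f x * (\<eta> x)\<^sup>2))"
proof (rule Bochner_Integration.integrable_bound)
  define V where "V = {x\<in>S. gradient f x \<noteq> 0}"
  note D = C1_compact_supportD[OF eta]
  have contg: "continuous_on S (gradient f)" by (rule C1_on_continuous_gradient[OF C2_onD(1)[OF S(2)]])
  have "V = S \<inter> gradient f -` (- {0})" by (auto simp: V_def)
  then have V: "open V"
    using continuous_open_preimage[OF contg S(1), of "- {0}"] by (simp add: open_Compl)
  have VS: "V \<subseteq> S" by (auto simp: V_def)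
  show "integrable lborel (\<lambda>x. hess_norm_sq f x * (\<eta> x)\<^sup>2)"
  proof (rule integrable_continuous_compact[OF _ D(2,3)])
    show "continuous_on S (\<lambda>x. hess_norm_sq f x * (\<eta> x)\<^sup>2)"
      by (intro continuous_intros continuous_on_hess_norm_sq S C1_compact_support_continuous[OF eta])
    show "hess_norm_sq f x * (\<eta> x)\<^sup>2 = 0" if "x \<notin> closure {x. \<eta> x \<noteq> 0}" for x
      using eq_zero_off_support[OF that] by (simp only: power_zero_numeral mult_zero_right)
  qed
  have eq: "curvature_density S f x = hess_norm_sq f x - (norm (hess f x (unit_normal f x)))\<^sup>2" if "x \<in> V" for x
    using curvature_identity[OF S] that by (auto simp: V_def curvature_density_def)
  have "continuous_on V (\<lambda>x. (hess_norm_sq f x - (norm (hess f x (unit_normal f x)))\<^sup>2) * (\<eta> x)\<^sup>2)"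
    unfolding unit_normal_def
    by (intro continuous_intros continuous_on_hess[OF S(2)] C1_compact_support_continuous[OF eta] VS
        continuous_on_subset[OF contg] continuous_on_subset[OF continuous_on_hess_norm_sq[OF S(2)]])
       (auto simp: V_def)
  then have "(\<lambda>x. indicator V x *\<^sub>R ((hess_norm_sq f x - (norm (hess f x (unit_normal f x)))\<^sup>2) * (\<eta> x)\<^sup>2))
      \<in> borel_measurable borel"
    by (rule borel_measurable_continuous_on_indicator[rotated]) (use V in simp)
  moreover have "indicator V x *\<^sub>R ((hess_norm_sq f x - (norm (hess f x (unit_normal f x)))\<^sup>2) * (\<eta> x)\<^sup>2)
      = indicator V x * (curvature_density S f x * (\<eta> x)\<^sup>2)" for x
    by (cases "x \<in> V") (simp_all add: eq)
  ultimately have "(\<lambda>x. indicator V x * (curvature_density S f x * (\<eta> x)\<^sup>2)) \<in> borel_measurable borel"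
    by (simp only:)
  then show "(\<lambda>x. indicator {x\<in>S. gradient f x \<noteq> 0} x * (curvature_density S f x * (\<eta> x)\<^sup>2))
      \<in> borel_measurable lborel"
    unfolding V_def by simp
  show "AE x in lborel. norm (indicator {x\<in>S. gradient f x \<noteq> 0} x * (curvature_density S f x * (\<eta> x)\<^sup>2))
      \<le> norm (hess_norm_sq f x * (\<eta> x)\<^sup>2)"
  proof (rule AE_I2)
    fix x
    show "norm (indicator {x\<in>S. gradient f x \<noteq> 0} x * (curvature_density S f x * (\<eta> x)\<^sup>2))
      \<le> norm (hess_norm_sq f x * (\<eta> x)\<^sup>2)"
    proof (cases "x \<in> V")
      case True
      have "\<bar>curvature_density S f x\<bar> \<le> \<bar>hess_norm_sq f x\<bar>"
        using curvature_density_nonneg[of S f x] eq[OF True]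
          zero_le_power2[of "norm (hess f x (unit_normal f x))"] by linarith
      then show ?thesis using True by (simp add: V_def abs_mult mult_right_mono)
    qed (simp add: V_def)
  qed
qed

text \<open>The energy of the regularised test function, with the cross term eliminated by the linearised
  energy identity. The only trace of \<open>\<epsilon>\<close> on the right is linear.\<close>
lemma test_function_energy_le:
  fixes f :: "real^'n \<Rightarrow> real"
  assumes S: "open S" "C2_on S f" and G: "C1_on S G" "\<And>x. x \<in> S \<Longrightarrow> laplacian f x = G x"
    and eta: "C1_compact_support S \<eta>" and eps: "\<epsilon> > 0"
  shows "(LINT x|lborel. (norm (gradient (\<lambda>y. reg_norm \<epsilon> (gradient f y) * \<eta> y) x))\<^sup>2)
    \<le> (LINT x|lborel. (norm (gradient f x))\<^sup>2 * (norm (gradient \<eta> x))\<^sup>2)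
      + \<epsilon> * (LINT x|lborel. (norm (gradient \<eta> x))\<^sup>2)
      - (LINT x|lborel. (gradient G x \<bullet> gradient f x) * (\<eta> x)\<^sup>2)
      - (LINT x|lborel. indicator {x\<in>S. gradient f x \<noteq> 0} x * (curvature_density S f x * (\<eta> x)\<^sup>2))"
proof -
  define K where "K = closure {x. \<eta> x \<noteq> 0}"
  note D = C1_compact_supportD[OF eta, folded K_def]
  have eta0: "\<eta> x = 0" "gradient \<eta> x = 0" if "x \<notin> K" for x
    using that eq_zero_off_support gradient_zero_off_support by (auto simp: K_def)
  note cont = C1_on_continuous_gradient[OF C2_onD(1)[OF S(2)]] C1_compact_support_continuous[OF eta]
    continuous_on_hess_norm_sq[OF S(2)] continuous_on_hess[OF S(2) C1_on_continuous_gradient[OF C2_onD(1)[OF S(2)]] order_refl]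
  define \<zeta> where "\<zeta> y = reg_norm \<epsilon> (gradient f y) * \<eta> y" for y
  have zeta: "C1_compact_support S \<zeta>"
    unfolding \<zeta>_def by (intro C1_compact_support_mult C1_on_reg_norm_gradient S eta eps)
  have zeta0: "gradient \<zeta> x = 0" if "x \<notin> K" for x
  proof -
    have "{x. \<zeta> x \<noteq> 0} \<subseteq> {x. \<eta> x \<noteq> 0}" by (auto simp: \<zeta>_def)
    then have "x \<notin> closure {x. \<zeta> x \<noteq> 0}" using that closure_mono by (auto simp: K_def)
    then show ?thesis by (rule gradient_zero_off_support)
  qed
  let ?A = "\<lambda>x. (norm (gradient f x))\<^sup>2 * (norm (gradient \<eta> x))\<^sup>2"
  let ?B = "\<lambda>x. (norm (gradient \<eta> x))\<^sup>2"
  let ?C = "\<lambda>x. hess_norm_sq f x * (\<eta> x)\<^sup>2 + 2 * \<eta> x * (hess f x (gradient f x) \<bullet> gradient \<eta> x)"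
  let ?R = "\<lambda>x. indicator {x\<in>S. gradient f x \<noteq> 0} x * (curvature_density S f x * (\<eta> x)\<^sup>2)"
  have int: "integrable lborel (\<lambda>x. (norm (gradient \<zeta> x))\<^sup>2)"
    by (rule integrable_continuous_compact[OF _ D(2,3)])
       (auto simp: zeta0 intro!: continuous_intros C1_compact_support_continuous[OF zeta])
  have intA: "integrable lborel ?A" and intB: "integrable lborel ?B" and intC: "integrable lborel ?C"
    by (rule integrable_continuous_compact[OF _ D(2,3)];
        auto simp: eta0 intro!: continuous_intros cont)+
  have intR: "integrable lborel ?R" by (rule integrable_curvature_density[OF S eta])
  have split: "(LINT x|lborel. a x + \<epsilon> * b x + c x - r x)
      = integral\<^sup>L lborel a + \<epsilon> * integral\<^sup>L lborel b + integral\<^sup>L lborel c - integral\<^sup>L lborel r"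
    if "integrable lborel a" "integrable lborel b" "integrable lborel c" "integrable lborel r"
    for a b c r :: "real^'n \<Rightarrow> real"
    using that by simp
  have "(LINT x|lborel. (norm (gradient \<zeta> x))\<^sup>2) \<le> (LINT x|lborel. ?A x + \<epsilon> * ?B x + ?C x - ?R x)"
  proof (rule integral_mono[OF int])
    show "integrable lborel (\<lambda>x. ?A x + \<epsilon> * ?B x + ?C x - ?R x)"
      by (intro Bochner_Integration.integrable_diff Bochner_Integration.integrable_add
          integrable_mult_right intA intB intC intR)
    fix x
    show "(norm (gradient \<zeta> x))\<^sup>2 \<le> ?A x + \<epsilon> * ?B x + ?C x - ?R x"
    proof (cases "x \<in> K")
      case True
      then have x: "x \<in> S" using D by auto
      have "(norm (hess f x (gradient f x)))\<^sup>2 / ((norm (gradient f x))\<^sup>2 + \<epsilon>) * (\<eta> x)\<^sup>2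
        \<le> (hess_norm_sq f x - indicator {x\<in>S. gradient f x \<noteq> 0} x * curvature_density S f x) * (\<eta> x)\<^sup>2"
        by (intro mult_right_mono reg_hess_le[OF S x eps]) auto
      then show ?thesis
        using norm_gradient_test_function[OF S C1_on_subset[OF D(1)] x eps, OF subset_UNIV]
        unfolding \<zeta>_def by (simp only: algebra_simps)
    qed (simp add: zeta0 eta0)
  qed
  also have "\<dots> = integral\<^sup>L lborel ?A + \<epsilon> * integral\<^sup>L lborel ?B + integral\<^sup>L lborel ?C - integral\<^sup>L lborel ?R"
    by (rule split[OF intA intB intC intR])
  also have "integral\<^sup>L lborel ?C = - (LINT x|lborel. (gradient G x \<bullet> gradient f x) * (\<eta> x)\<^sup>2)"
    by (rule linearized_energy_identity[OF S G eta])
  finally show ?thesis unfolding \<zeta>_def by simp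
qed

section \<open>The geometric Poincare inequality\<close>

lemma gradient_compose_vector:
  fixes F :: "real^'m \<Rightarrow> real" and u :: "real^'n \<Rightarrow> real^'m"
  assumes S: "open S" "\<And>i. C1_on S (\<lambda>x. u x $ i)" and F: "C1_on UNIV F"
  shows "C1_on S (\<lambda>x. F (u x))"
    and "x \<in> S \<Longrightarrow> gradient (\<lambda>x. F (u x)) x = (\<Sum>j\<in>UNIV. partial j F (u x) *\<^sub>R gradient (\<lambda>x. u x $ j) x)"
proof -
  let ?g = "\<lambda>x. \<Sum>j\<in>UNIV. partial j F (u x) *\<^sub>R gradient (\<lambda>x. u x $ j) x"
  have der: "((\<lambda>x. F (u x)) has_derivative (\<lambda>h. ?g x \<bullet> h)) (at x)" if x: "x \<in> S" for x
  proof -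
    have "(u has_derivative (\<lambda>h. \<chi> j. gradient (\<lambda>x. u x $ j) x \<bullet> h)) (at x)"
    proof (subst has_derivative_componentwise_within, rule ballI)
      fix i :: "real^'m" assume "i \<in> Basis"
      then obtain k where k: "i = axis k 1" by (auto simp: Basis_vec_def)
      show "((\<lambda>y. u y \<bullet> i) has_derivative (\<lambda>h. (\<chi> j. gradient (\<lambda>x. u x $ j) x \<bullet> h) \<bullet> i)) (at x)"
        using C1_on_has_derivative[OF S(1) S(2) x, of k] by (simp add: k inner_axis)
    qed
    from diff_chain_at[OF this C1_on_has_derivative[OF open_UNIV F UNIV_I]]
    have "((\<lambda>x. F (u x)) has_derivative (\<lambda>h. gradient F (u x) \<bullet> (\<chi> j. gradient (\<lambda>x. u x $ j) x \<bullet> h))) (at x)"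
      by (simp only: o_def)
    moreover have "gradient F (u x) \<bullet> (\<chi> j. gradient (\<lambda>x. u x $ j) x \<bullet> h) = ?g x \<bullet> h" for h
      by (subst inner_vec_def) (simp add: inner_sum_left)
    ultimately show ?thesis by simp
  qed
  have contu: "continuous_on S u"
    using S(2) C1_on_continuous by (subst continuous_on_componentwise) (auto simp: Basis_vec_def inner_axis)
  show "C1_on S (\<lambda>x. F (u x))"
  proof (rule C1_onI[OF der])
    show "continuous_on S ?g"
      by (intro continuous_intros C1_on_continuous_gradient S
          continuous_on_compose2[OF C1_on_continuous_partial[OF F] contu] subset_UNIV)
  qed
  show "x \<in> S \<Longrightarrow> gradient (\<lambda>x. F (u x)) x = ?g x" by (rule gradient_eq[OF der])
qed

lemma reg_norm_tendsto: "(\<lambda>n. reg_norm (1 / real (Suc n)) v) \<longlonglongrightarrow> norm v"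
proof -
  have "(\<lambda>n. sqrt ((norm v)\<^sup>2 + 1 / real (Suc n))) \<longlonglongrightarrow> sqrt ((norm v)\<^sup>2 + 0)"
    by (intro tendsto_intros LIMSEQ_Suc[OF lim_const_over_n[of 1]])
  then show ?thesis by (simp add: reg_norm_def)
qed

theorem theorem3:
  fixes \<Omega> :: "(real^'n) set"
    and H :: "real^'m \<Rightarrow> real"
    and u :: "real^'n \<Rightarrow> real^'m"
    and \<eta> :: "'m \<Rightarrow> real^'n \<Rightarrow> real"
  defines "U \<equiv> \<lambda>i x. u x $ i"
  assumes "open \<Omega>"
    and "C2_on UNIV H"
    and "classical_solution \<Omega> H u"
    and "stable_on \<Omega> H u"
    and "\<And>k. C1_compact_support \<Omega> (\<eta> k)"
  shows "(\<Sum>i\<in>UNIV. LINT x:\<Omega>|lborel. (norm (gradient (U i) x))\<^sup>2 * (norm (gradient (\<eta> i) x))\<^sup>2)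
    \<ge> (\<Sum>i\<in>UNIV. LINT x:{x\<in>\<Omega>. gradient (U i) x \<noteq> 0}|lborel.
          ((norm (gradient (U i) x))\<^sup>2 * sum_sq_curvatures \<Omega> (U i) x
           + (norm (tangential_gradient (level_set \<Omega> (U i) x)
                      (\<lambda>y. norm (gradient (U i) y)) x))\<^sup>2) * (\<eta> i x)\<^sup>2)
      + (\<Sum>(i, j)\<in>{(i, j). i \<noteq> j}. LINT x:\<Omega>|lborel.
          ((gradient (U i) x \<bullet> gradient (U j) x) * (\<eta> i x)\<^sup>2
           - norm (gradient (U i) x) * norm (gradient (U j) x) * \<eta> i x * \<eta> j x)
          * partial j (partial i H) (u x))"
proof -
  note eta = assms(6)
  have C2: "C2_on \<Omega> (U i)" for i using assms(4) by (simp add: classical_solution_def U_def)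
  note C1 = C2_onD(1)[OF C2]
  have pde: "laplacian (U i) x = partial i H (u x)" if "x \<in> \<Omega>" for i x
    using assms(4) that by (simp add: classical_solution_def U_def)
  define h where "h i j x = partial j (partial i H) (u x)" for i j x
  note chain = gradient_compose_vector[OF assms(2) C1[unfolded U_def] C2_onD(2)[OF assms(3)], folded U_def]
  have grad_comp: "gradient (\<lambda>x. partial i H (u x)) x \<bullet> gradient (U i) x
      = (\<Sum>j\<in>UNIV. h i j x * (gradient (U i) x \<bullet> gradient (U j) x))" if "x \<in> \<Omega>" for i x
  proof -
    have "gradient (\<lambda>x. partial i H (u x)) x = (\<Sum>j\<in>UNIV. h i j x *\<^sub>R gradient (U j) x)"
      using chain(2)[OF that] by (simp add: h_def U_def)
    then show ?thesis by (simp add: inner_sum_left) (simp add: inner_commute)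
  qed
  have contu: "continuous_on \<Omega> u"
    using C1 C1_on_continuous by (subst continuous_on_componentwise) (auto simp: Basis_vec_def inner_axis U_def)
  have conth: "continuous_on \<Omega> (h i j)" for i j
    unfolding h_def
    by (intro continuous_on_compose2[OF C1_on_continuous_partial[OF C2_onD(2)[OF assms(3)]] contu] subset_UNIV)
  define K where "K i = closure {x. \<eta> i x \<noteq> 0}" for i
  note D = C1_compact_supportD[OF eta, folded K_def]
  have eta0: "\<eta> i x = 0" "gradient (\<eta> i) x = 0" if "x \<notin> K i" for x i
    using that eq_zero_off_support gradient_zero_off_support by (auto simp: K_def)
  have eta_Om: "\<eta> i x = 0" "gradient (\<eta> i) x = 0" if "x \<notin> \<Omega>" for x i
    using eta0[of x i] D(3)[of i] that by auto
  note cont = C1_on_continuous_gradient[OF C1] conth C1_compact_support_continuous[OF eta]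

  define R where "R i = (LINT x|lborel. indicator {x\<in>\<Omega>. gradient (U i) x \<noteq> 0} x * (curvature_density \<Omega> (U i) x * (\<eta> i x)\<^sup>2))" for i
  define P where "P i = (LINT x|lborel. (norm (gradient (U i) x))\<^sup>2 * (norm (gradient (\<eta> i) x))\<^sup>2)" for i
  define E where "E i = (LINT x|lborel. (norm (gradient (\<eta> i) x))\<^sup>2)" for i
  define I1 where "I1 i j = (LINT x|lborel. h i j x * (gradient (U i) x \<bullet> gradient (U j) x) * (\<eta> i x)\<^sup>2)" for i j
  define I2 where "I2 i j N = (LINT x|lborel. h i j x * N (gradient (U i) x) * N (gradient (U j) x) * \<eta> i x * \<eta> j x)"
    for i j and N :: "real^'n \<Rightarrow> real"
  have int1: "integrable lborel (\<lambda>x. h i j x * (gradient (U i) x \<bullet> gradient (U j) x) * (\<eta> i x)\<^sup>2)" for i j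
    by (rule integrable_continuous_compact[OF _ D(2,3)[of i]])
       (auto simp: eta0 intro!: continuous_intros cont)
  have int2: "integrable lborel (\<lambda>x. h i j x * N (gradient (U i) x) * N (gradient (U j) x) * \<eta> i x * \<eta> j x)"
    if "continuous_on UNIV N" for N i j
    by (rule integrable_continuous_compact[OF _ D(2,3)[of i]])
       (auto simp: eta0 intro!: continuous_intros cont continuous_on_compose2[OF that])
  have contreg: "continuous_on UNIV (reg_norm \<epsilon> :: real^'n \<Rightarrow> real)" for \<epsilon>
    by (intro continuous_intros)

  \<comment> \<open>Stability for the regularised test functions. \<open>I1\<close> comes from the linearised equation and \<open>I2\<close>
    from the quadratic form of stability, with the norm to be regularised left as a parameter.\<close>
  have stable: "0 \<le> (\<Sum>i\<in>UNIV. P i + \<epsilon> * E i - (\<Sum>j\<in>UNIV. I1 i j) - R i) + (\<Sum>i\<in>UNIV. \<Sum>j\<in>UNIV. I2 i j (reg_norm \<epsilon>))"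
    if eps: "\<epsilon> > 0" for \<epsilon>
  proof -
    define \<zeta> where "\<zeta> i y = reg_norm \<epsilon> (gradient (U i) y) * \<eta> i y" for i y
    have zeta: "C1_compact_support \<Omega> (\<zeta> i)" for i
      unfolding \<zeta>_def by (intro C1_compact_support_mult C1_on_reg_norm_gradient assms(2) C2 eta eps)
    have grad0: "gradient (\<zeta> i) x = 0" if "x \<notin> \<Omega>" for i x
      using that C1_compact_supportD(3)[OF zeta] by (intro gradient_zero_off_support) auto
    have "0 \<le> (\<Sum>i\<in>UNIV. LINT x:\<Omega>|lborel. (norm (gradient (\<zeta> i) x))\<^sup>2)
        + (\<Sum>i\<in>UNIV. \<Sum>j\<in>UNIV. LINT x:\<Omega>|lborel. partial j (partial i H) (u x) * \<zeta> i x * \<zeta> j x)"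
      using assms(5) zeta unfolding stable_on_def by blast
    also have "\<dots> = (\<Sum>i\<in>UNIV. LINT x|lborel. (norm (gradient (\<zeta> i) x))\<^sup>2) + (\<Sum>i\<in>UNIV. \<Sum>j\<in>UNIV. I2 i j (reg_norm \<epsilon>))"
    proof (intro arg_cong2[where f="(+)"] sum.cong refl)
      show "(LINT x:\<Omega>|lborel. (norm (gradient (\<zeta> i) x))\<^sup>2) = (LINT x|lborel. (norm (gradient (\<zeta> i) x))\<^sup>2)" for i
        by (rule set_lebesgue_integral_eq_UNIV) (simp add: grad0)
      show "(LINT x:\<Omega>|lborel. partial j (partial i H) (u x) * \<zeta> i x * \<zeta> j x) = I2 i j (reg_norm \<epsilon>)" for i j
        unfolding I2_def
        by (subst set_lebesgue_integral_eq_UNIV) (auto simp: \<zeta>_def eta_Om h_def mult_ac)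
    qed
    also have "\<dots> \<le> (\<Sum>i\<in>UNIV. P i + \<epsilon> * E i - (\<Sum>j\<in>UNIV. I1 i j) - R i) + (\<Sum>i\<in>UNIV. \<Sum>j\<in>UNIV. I2 i j (reg_norm \<epsilon>))"
    proof (intro add_right_mono sum_mono)
      fix i
      have "(LINT x|lborel. (gradient (\<lambda>x. partial i H (u x)) x \<bullet> gradient (U i) x) * (\<eta> i x)\<^sup>2)
          = (LINT x|lborel. (\<Sum>j\<in>UNIV. h i j x * (gradient (U i) x \<bullet> gradient (U j) x) * (\<eta> i x)\<^sup>2))"
      proof (rule Bochner_Integration.integral_cong[OF refl])
        fix x show "(gradient (\<lambda>x. partial i H (u x)) x \<bullet> gradient (U i) x) * (\<eta> i x)\<^sup>2
          = (\<Sum>j\<in>UNIV. h i j x * (gradient (U i) x \<bullet> gradient (U j) x) * (\<eta> i x)\<^sup>2)"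
          by (cases "x \<in> \<Omega>") (simp_all add: grad_comp sum_distrib_right eta_Om)
      qed
      also have "\<dots> = (\<Sum>j\<in>UNIV. I1 i j)"
        unfolding I1_def by (rule Bochner_Integration.integral_sum) (rule int1)
      finally show "(LINT x|lborel. (norm (gradient (\<zeta> i) x))\<^sup>2) \<le> P i + \<epsilon> * E i - (\<Sum>j\<in>UNIV. I1 i j) - R i"
        using test_function_energy_le[OF assms(2) C2 chain(1) pde eta eps, of i i]
        by (simp add: P_def E_def R_def \<zeta>_def[abs_def])
    qed
    finally show ?thesis .
  qed

  have lim2: "(\<lambda>n. I2 i j (reg_norm (1 / real (Suc n)))) \<longlonglongrightarrow> I2 i j norm" for i j
    unfolding I2_def
  proof (rule integral_dominated_convergence[where
        w="\<lambda>x. \<bar>h i j x * reg_norm 1 (gradient (U i) x) * reg_norm 1 (gradient (U j) x) * \<eta> i x * \<eta> j x\<bar>"])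
    show "integrable lborel (\<lambda>x. \<bar>h i j x * reg_norm 1 (gradient (U i) x) * reg_norm 1 (gradient (U j) x) * \<eta> i x * \<eta> j x\<bar>)"
      by (intro integrable_abs int2 contreg)
    show "(\<lambda>x. h i j x * norm (gradient (U i) x) * norm (gradient (U j) x) * \<eta> i x * \<eta> j x) \<in> borel_measurable lborel"
      by (intro borel_measurable_integrable int2 continuous_intros)
    show "(\<lambda>x. h i j x * reg_norm (1 / real (Suc n)) (gradient (U i) x) * reg_norm (1 / real (Suc n)) (gradient (U j) x) * \<eta> i x * \<eta> j x)
        \<in> borel_measurable lborel" for n
      by (intro borel_measurable_integrable int2 contreg)
    show "AE x in lborel. (\<lambda>n. h i j x * reg_norm (1 / real (Suc n)) (gradient (U i) x) * reg_norm (1 / real (Suc n)) (gradient (U j) x) * \<eta> i x * \<eta> j x)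
        \<longlonglongrightarrow> h i j x * norm (gradient (U i) x) * norm (gradient (U j) x) * \<eta> i x * \<eta> j x"
      by (intro AE_I2 tendsto_intros reg_norm_tendsto)
    have le: "reg_norm (1 / real (Suc n)) v \<le> reg_norm 1 v" "0 \<le> reg_norm (1 / real (Suc n)) v" for n and v :: "real^'n"
      by (simp_all add: reg_norm_def)
    show "AE x in lborel. norm (h i j x * reg_norm (1 / real (Suc n)) (gradient (U i) x) * reg_norm (1 / real (Suc n)) (gradient (U j) x) * \<eta> i x * \<eta> j x)
        \<le> \<bar>h i j x * reg_norm 1 (gradient (U i) x) * reg_norm 1 (gradient (U j) x) * \<eta> i x * \<eta> j x\<bar>" for n
    proof (rule AE_I2)
      fix x
      have "\<bar>reg_norm (1 / real (Suc n)) v\<bar> \<le> \<bar>reg_norm 1 v\<bar>" for v :: "real^'n"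
        using le[of n v] by linarith
      then show "norm (h i j x * reg_norm (1 / real (Suc n)) (gradient (U i) x) * reg_norm (1 / real (Suc n)) (gradient (U j) x) * \<eta> i x * \<eta> j x)
        \<le> \<bar>h i j x * reg_norm 1 (gradient (U i) x) * reg_norm 1 (gradient (U j) x) * \<eta> i x * \<eta> j x\<bar>"
        unfolding real_norm_def abs_mult by (intro mult_right_mono mult_mono mult_nonneg_nonneg order_refl) auto
    qed
  qed
  have lim: "(\<lambda>n. (\<Sum>i\<in>UNIV. P i + (1 / real (Suc n)) * E i - (\<Sum>j\<in>UNIV. I1 i j) - R i)
        + (\<Sum>i\<in>UNIV. \<Sum>j\<in>UNIV. I2 i j (reg_norm (1 / real (Suc n)))))
      \<longlonglongrightarrow> (\<Sum>i\<in>UNIV. P i + 0 * E i - (\<Sum>j\<in>UNIV. I1 i j) - R i) + (\<Sum>i\<in>UNIV. \<Sum>j\<in>UNIV. I2 i j norm)"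
    by (intro tendsto_intros lim2 LIMSEQ_Suc[OF lim_const_over_n[of 1]])
  have "0 \<le> (\<Sum>i\<in>UNIV. P i + 0 * E i - (\<Sum>j\<in>UNIV. I1 i j) - R i) + (\<Sum>i\<in>UNIV. \<Sum>j\<in>UNIV. I2 i j norm)"
    by (rule LIMSEQ_le_const[OF lim]) (intro exI[of _ 0] allI impI stable, simp)
  then have main: "(\<Sum>i\<in>UNIV. R i) + (\<Sum>i\<in>UNIV. \<Sum>j\<in>UNIV. I1 i j - I2 i j norm) \<le> (\<Sum>i\<in>UNIV. P i)"
    by (simp add: sum_subtractf)

  define J where "J i j = (LINT x:\<Omega>|lborel.
          ((gradient (U i) x \<bullet> gradient (U j) x) * (\<eta> i x)\<^sup>2
           - norm (gradient (U i) x) * norm (gradient (U j) x) * \<eta> i x * \<eta> j x)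
          * partial j (partial i H) (u x))" for i j
  have J: "J i j = I1 i j - I2 i j norm" for i j
  proof -
    have "J i j = (LINT x|lborel. h i j x * (gradient (U i) x \<bullet> gradient (U j) x) * (\<eta> i x)\<^sup>2
        - h i j x * norm (gradient (U i) x) * norm (gradient (U j) x) * \<eta> i x * \<eta> j x)"
      unfolding J_def by (subst set_lebesgue_integral_eq_UNIV) (auto simp: eta_Om h_def algebra_simps)
    also have "\<dots> = I1 i j - I2 i j norm"
      unfolding I1_def I2_def by (rule Bochner_Integration.integral_diff[OF int1 int2]) (intro continuous_intros)
    finally show ?thesis .
  qed
  have J_diag: "J i i = 0" for i
    by (simp add: J_def power2_eq_square set_lebesgue_integral_def flip: power2_norm_eq_inner)
  have "(\<Sum>(i, j)\<in>{(i, j). i \<noteq> j}. J i j) = (\<Sum>(i, j)\<in>UNIV \<times> UNIV. J i j)"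
    by (rule sum.mono_neutral_left) (auto simp: J_diag)
  also have "\<dots> = (\<Sum>i\<in>UNIV. \<Sum>j\<in>UNIV. I1 i j - I2 i j norm)"
    by (simp only: sum.cartesian_product J)
  finally have sumJ: "(\<Sum>(i, j)\<in>{(i, j). i \<noteq> j}. J i j) = (\<Sum>i\<in>UNIV. \<Sum>j\<in>UNIV. I1 i j - I2 i j norm)" .
  have R: "(LINT x:{x\<in>\<Omega>. gradient (U i) x \<noteq> 0}|lborel.
          ((norm (gradient (U i) x))\<^sup>2 * sum_sq_curvatures \<Omega> (U i) x
           + (norm (tangential_gradient (level_set \<Omega> (U i) x)
                      (\<lambda>y. norm (gradient (U i) y)) x))\<^sup>2) * (\<eta> i x)\<^sup>2) = R i" for i
    by (simp add: R_def set_lebesgue_integral_def curvature_density_def)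
  have P: "(LINT x:\<Omega>|lborel. (norm (gradient (U i) x))\<^sup>2 * (norm (gradient (\<eta> i) x))\<^sup>2) = P i" for i
    unfolding P_def by (rule set_lebesgue_integral_eq_UNIV) (simp add: eta_Om)
  show ?thesis
    using main unfolding R P sumJ[symmetric] J_def .
qed

end
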